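(* In general, the map $\Phi:(\mathsf{BString}(n)^p_c)^+\to(\mathsf{TC}^p_c)^+$ is not injective on the level of objects and not fully faithful; i.e. there exist $n$ and a manifold $M$ such that $\Phi(M)$ is not injective on objects and there are string data $P_c,P_c'$ over $M$ for which the functor $\mathrm{Hom}(P_c,P'_c)\to\mathrm{Hom}(\Phi(P_c),\Phi(P'_c))$ is not an equivalence.
   Context: Conventions. $G=\mathrm{Spin}(n)$, $\mathfrak g=\mathfrak{so}(n)$ with the fixed nondegenerate invariant symmetric bilinear form $(-,-)^{\mathfrak g}$ normalised so that $(R,R)^{\mathfrak g}$ represents the real class of $\tfrac12p_1$; $\theta_{MC}$ the right-invariant Maurer–Cartan form; $\mathrm{cs}_3(\theta)=(\theta,d\theta)^{\mathfrak g}+\tfrac13(\theta,[\theta,\theta])^{\mathfrak g}$; $U(1)=\mathbb R/\mathbb Z$, $d\log f$ locally the differential of a real lift; $\check\delta$ the Čech differential. $\mathrm{String}(n)$: the Lie 2-group which is the $\mathsf BU(1)$-central extension of $G$ with class $\tfrac12p_1\in H^4(BG_\bullet,\mathbb Z)\cong H^3(BG_\bullet,\underline{U(1)})$; for a good simplicial hypercover of $BG_\bullet$ and representing cocycle $(\Theta,\Psi,\eta,0)$ it is presented by the Lie groupoid $\Gamma[\eta]=(\sqcup G^{(1)}_{\alpha\beta}\times U(1)\rightrightarrows\sqcup G^{(1)}_\alpha)$, $(g_{\alpha\beta},a)(g_{\beta\gamma},b)=(g_{\alpha\gamma},a+b-\eta_{\alpha\beta\gamma}(g))$, with multiplication defined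 by $\Psi$ and associator $\Theta$. A morphism $g:U\to\mathrm{String}(n)$ is a principal $\Gamma[\eta]$-bundle (bibundle) over $U$, with underlying $\bar g:U\to G$. Over sufficiently fine good covers these bibundles are trivial(ized) and 2-isomorphisms are $U(1)$-valued functions. Objects of $(\mathsf{BString}(n)^p_c)^+(M)$: an open cover $\{U_i\}$ with string data $P_c=(\theta_i,B_i;g_{ij},A_{ij},\omega^2_{ij};f_{ijk},\omega^1_{ijk})$: $\theta_i\in\Omega^1(U_i,\mathfrak g)$, $B_i\in\Omega^2(U_i)$, $g_{ij}:U_{ij}\to\mathrm{String}(n)$, $A_{ij}\in\Omega^1(U_{ij})$, $\omega^2_{ij}\in\Omega^2(U_{ij})$, $f_{ijk}:U_{ijk}\to U(1)$ an isomorphism $g_{ik}\Rightarrow g_{ij}g_{jk}$, $\omega^1_{ijk}\in\Omega^1(U_{ijk})$, with $B_j-B_i=dA_{ij}+\omega^2_{ij}$, $\mathrm{cs}_3(\theta_j)-\mathrm{cs}_3(\theta_i)=d\omega^2_{ij}$, $\theta_i-\mathrm{Ad}_{\bar g_{ij}}\theta_j=-\bar g_{ij}^*\theta_{MC}$, $\check\delta A=\omega^1-d\log f$, $\check\delta\omega^2=-d\omega^1$, and the pentagon condition $\check\delta f=F$, $F$ being the function expressing the associator of $\mathrm{String}(n)$ on $(g_{ij},g_{jk},g_{kl})$. 1-morphisms (over a common refinement) from tilded to untilded data: $(g_i,A_i,\omega^2_i;f_{ij},\omega^1_{ij})$ with $g_i:U_i\to\mathrm{String}(n)$, $\tilde B_i-B_i=\omega_i^2+dA_i$,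 $d\omega^2_i=\mathrm{cs}_3(\tilde\theta_i)-\mathrm{cs}_3(\theta_i)$, $\theta_i-\mathrm{Ad}_{\bar g_i}\tilde\theta_i=-\bar g_i^*\theta_{MC}$, $f_{ij}:g_i\tilde g_{ij}\Rightarrow g_{ij}g_j$, $A_{ij}+A_j-A_i-\tilde A_{ij}=\omega^1_{ij}-d\log f_{ij}$, $\omega^2_{ij}+\omega^2_j-\tilde\omega^2_{ij}-\omega^2_i=-d\omega^1_{ij}$, and the coherence condition on triple overlaps ($f_{ijk}\tilde f_{ijk}^{-1}=(\check\delta f_{..})_{ijk}$ in trivializations). 2-morphisms from $(\tilde g_i,\tilde A_i,\tilde\omega_i^2;\tilde f_{ij},\tilde\omega^1_{ij})$ to $(g_i,A_i,\omega_i^2;f_{ij},\omega^1_{ij})$: $(f_i,\omega^1_i)$ with $f_i:\tilde g_i\Rightarrow g_i$, $A_i-\tilde A_i=-d\log f_i+\omega^1_i$, $\omega_i^2-\tilde\omega_i^2=-d\omega_i^1$, $f_{ij}\tilde f_{ij}^{-1}=f_jf_i^{-1}$, $\omega^1_{ij}-\tilde\omega^1_{ij}=\omega^1_j-\omega^1_i$. Objects of $(\mathsf{TC}^p_c)^+(M)$: an open cover with transitive Courant data $(\theta_i,B_i;\phi_{ij},\tau_{ij},\beta_{ij})$, i.e. $\theta_i\in\Omega^1(U_i,\mathfrak g)$, $B_i\in\Omega^2(U_i)$, and automorphisms $\Lambda_{ij}=\begin{pmatrix}1&0&0\\\phi_{ij}&\tau_{ij}&0\\\beta_{ij}&-2\phi_{ij}^\star\tau_{ij}&1\end{pmatrix}$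 of the standard transitive Courant algebroid $TU_{ij}\oplus(U_{ij}\times\mathfrak g)\oplus T^*U_{ij}$ (anchor the projection; pairing $\tfrac12(\xi(Y)+\eta(X))+(a,b)^{\mathfrak g}$; bracket $[X,Y]+X(b)-Y(a)+[a,b]_{\mathfrak g}+L_X\eta-\iota_Yd\xi+2(b,d a)^{\mathfrak g}$; $\phi^\star(a)(X)=(a,\phi(X))^{\mathfrak g}$) which are 1-morphisms from $(\theta_j,B_j)$ to $(\theta_i,B_i)$, with $\Lambda_{ij}\Lambda_{jk}=\Lambda_{ik}$. Here $(\phi,\tau,\beta)$ is a 1-morphism from $(\tilde\theta,\tilde B)$ to $(\theta,B)$ if $\theta=\tau\tilde\theta+\phi$, $\iota_X(\tilde B-B)=\beta(X)+(\theta,\theta(X))^{\mathfrak g}-(\tilde\theta,\tilde\theta(X))^{\mathfrak g}-2\phi^\star\tau(\tilde\theta(X))$, $\mathrm{cs}_3(\tilde\theta)-\mathrm{cs}_3(\theta)=d(\tilde B-B)$. 1-morphisms of Courant data: families of 1-morphisms $\Lambda_i:(\tilde\theta_i,\tilde B_i)\to(\theta_i,B_i)$ (over a common refinement) with $\Lambda_{ij}\Lambda_j=\Lambda_i\tilde\Lambda_{ij}$; 2-morphisms are identities. $\Phi$: $(\theta_i,B_i;g_{ij},A_{ij},\omega^2_{ij};f_{ijk},\omega^1_{ijk})\mapsto(\theta_i,B_i;-\mu_{ij},\mathrm{Ad}_{\bar g_{ij}},\beta_{ij})$ with $\mu_{ij}=\bar g_{ij}^*\theta_{MC}$ and $\beta_{ij}(X)=\iota_X(dA_{ij}+\omega^2_{ij})+(\mu_{ij}(X),\theta_i(\cdot))^{\mathfrak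 g}-(\mu_{ij}(\cdot),\theta_i(X))^{\mathfrak g}-(\mu_{ij}(X),\mu_{ij}(\cdot))^{\mathfrak g}$; on 1-morphisms by the same formula with $(g_i,A_i,\omega^2_i)$ in place of $(g_{ij},A_{ij},\omega^2_{ij})$; 2-morphisms go to identities. *)

theory Defs
  imports "HOL-Analysis.Analysis" "HOL-Library.Poly_Mapping"
begin

section \<open>Finitely supported families as Euclidean spaces of unspecified dimension\<close>

text \<open>The dimensions of the manifold and of the Spin group are bound inside the statement, so all
  Euclidean spaces are taken inside finitely supported families with the \<open>\<ell>\<^sup>2\<close> inner product.\<close>

instantiation poly_mapping :: (type, real_vector) real_vector
begin

definition scaleR_poly_mapping :: "real \<Rightarrow> ('a \<Rightarrow>\<^sub>0 'b) \<Rightarrow> ('a \<Rightarrow>\<^sub>0 'b)" where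
  "scaleR_poly_mapping r f = Poly_Mapping.map (scaleR r) f"

lemma lookup_scaleR: "Poly_Mapping.lookup (r *\<^sub>R f) k = r *\<^sub>R Poly_Mapping.lookup f k"
  by (simp add: scaleR_poly_mapping_def map.rep_eq when_def)

instance
  by standard (auto intro!: poly_mapping_eqI simp: lookup_scaleR lookup_add algebra_simps)

end

instantiation poly_mapping :: (type, real_inner) real_inner
begin

definition inner_poly_mapping :: "('a \<Rightarrow>\<^sub>0 'b) \<Rightarrow> ('a \<Rightarrow>\<^sub>0 'b) \<Rightarrow> real" where
  "inner_poly_mapping f g =
     (\<Sum>k\<in>Poly_Mapping.keys f. Poly_Mapping.lookup f k \<bullet> Poly_Mapping.lookup g k)"

definition norm_poly_mapping :: "('a \<Rightarrow>\<^sub>0 'b) \<Rightarrow> real" where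
  "norm_poly_mapping f = sqrt (f \<bullet> f)"

definition dist_poly_mapping :: "('a \<Rightarrow>\<^sub>0 'b) \<Rightarrow> ('a \<Rightarrow>\<^sub>0 'b) \<Rightarrow> real" where
  "dist_poly_mapping f g = norm (f - g)"

definition sgn_poly_mapping :: "('a \<Rightarrow>\<^sub>0 'b) \<Rightarrow> ('a \<Rightarrow>\<^sub>0 'b)" where
  "sgn_poly_mapping f = f /\<^sub>R norm f"

definition uniformity_poly_mapping :: "(('a \<Rightarrow>\<^sub>0 'b) \<times> ('a \<Rightarrow>\<^sub>0 'b)) filter" where
  "uniformity_poly_mapping = (INF e\<in>{0<..}. principal {(x, y). dist x y < e})"

definition open_poly_mapping :: "('a \<Rightarrow>\<^sub>0 'b) set \<Rightarrow> bool" where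
  "open_poly_mapping U \<longleftrightarrow> (\<forall>x\<in>U. \<forall>\<^sub>F (x', y) in uniformity. x' = x \<longrightarrow> y \<in> U)"

lemma inner_poly_mapping_superset:
  fixes f g :: "'a \<Rightarrow>\<^sub>0 'b"
  assumes "finite K" "Poly_Mapping.keys f \<subseteq> K"
  shows "f \<bullet> g = (\<Sum>k\<in>K. Poly_Mapping.lookup f k \<bullet> Poly_Mapping.lookup g k)"
  unfolding inner_poly_mapping_def
  by (rule sum.mono_neutral_left) (use assms in \<open>auto simp: in_keys_iff\<close>)

instance
proof
  fix x y z :: "'a \<Rightarrow>\<^sub>0 'b" and r :: real
  let ?K = "Poly_Mapping.keys x \<union> Poly_Mapping.keys y"
  have fin: "finite ?K" by simp
  show "dist x y = norm (x - y)" by (rule dist_poly_mapping_def)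
  show "sgn x = x /\<^sub>R norm x" by (rule sgn_poly_mapping_def)
  show "uniformity = (INF e\<in>{0<..}. principal {(x::'a \<Rightarrow>\<^sub>0 'b, y). dist x y < e})"
    by (rule uniformity_poly_mapping_def)
  show "open U \<longleftrightarrow> (\<forall>x\<in>U. \<forall>\<^sub>F (x', y) in uniformity. x' = x \<longrightarrow> y \<in> U)" for U :: "('a \<Rightarrow>\<^sub>0 'b) set"
    by (rule open_poly_mapping_def)
  show "x \<bullet> y = y \<bullet> x"
    using inner_poly_mapping_superset[OF fin, of x y] inner_poly_mapping_superset[OF fin, of y x]
    by (simp add: inner_commute)
  have "Poly_Mapping.keys (x + y) \<subseteq> ?K" by (rule Poly_Mapping.keys_add)
  then show "(x + y) \<bullet> z = x \<bullet> z + y \<bullet> z"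
    using inner_poly_mapping_superset[OF fin, of x z] inner_poly_mapping_superset[OF fin, of y z]
      inner_poly_mapping_superset[OF fin, of "x + y" z]
    by (simp add: lookup_add inner_add_left sum.distrib)
  have "Poly_Mapping.keys (r *\<^sub>R x) \<subseteq> Poly_Mapping.keys x"
    by (auto simp: in_keys_iff lookup_scaleR)
  then show "(r *\<^sub>R x) \<bullet> y = r * (x \<bullet> y)"
    using inner_poly_mapping_superset[of "Poly_Mapping.keys x" "r *\<^sub>R x" y]
    by (simp add: lookup_scaleR inner_poly_mapping_def sum_distrib_left)
  show "0 \<le> x \<bullet> x" by (simp add: inner_poly_mapping_def sum_nonneg)
  show "x \<bullet> x = 0 \<longleftrightarrow> x = 0"
  proof
    assume "x \<bullet> x = 0"
    then have "\<forall>k\<in>Poly_Mapping.keys x. Poly_Mapping.lookup x k = 0"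
      by (simp add: inner_poly_mapping_def sum_nonneg_eq_0_iff)
    then show "x = 0" by (auto intro!: poly_mapping_eqI simp: in_keys_iff)
  qed (simp add: inner_poly_mapping_def)
  show "norm x = sqrt (x \<bullet> x)" by (rule norm_poly_mapping_def)
qed

end

type_synonym rvec = "nat \<Rightarrow>\<^sub>0 real"

definition coords :: "nat \<Rightarrow> rvec set" where
  "coords m = {x. Poly_Mapping.keys x \<subseteq> {..<m}}"

section \<open>Calculus on subsets of normed spaces, submanifolds, differential forms\<close>

primrec Ck_on :: "nat \<Rightarrow> 'a::real_normed_vector set \<Rightarrow> ('a \<Rightarrow> 'b::real_normed_vector) \<Rightarrow> bool" where
  "Ck_on 0 U f \<longleftrightarrow> continuous_on U f"
| "Ck_on (Suc k) U f \<longleftrightarrow> (\<forall>x\<in>U. f differentiable (at x)) \<and>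
     (\<forall>v. Ck_on k U (\<lambda>x. frechet_derivative f (at x) v))"

text \<open>Smoothness on an arbitrary subset: local extendability to a smooth map of the ambient space.\<close>

definition smooth_on ::
  "'a::real_normed_vector set \<Rightarrow> ('a \<Rightarrow> 'b::real_normed_vector) \<Rightarrow> bool" where
  "smooth_on S f \<longleftrightarrow> (\<forall>x\<in>S. \<exists>U h. open U \<and> x \<in> U \<and> (\<forall>k. Ck_on k U h) \<and> (\<forall>y\<in>S \<inter> U. f y = h y))"

text \<open>\<open>m\<close>-dimensional manifolds, realised (without loss of generality, by Whitney's theorem) as
  embedded submanifolds of some Euclidean space.\<close>

definition submanifold :: "nat \<Rightarrow> rvec set \<Rightarrow> bool" where
  "submanifold m M \<longleftrightarrow> (\<exists>N. M \<subseteq> coords N) \<and>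
     (\<forall>x\<in>M. \<exists>W V \<phi> \<psi>. openin (top_of_set M) W \<and> x \<in> W \<and> openin (top_of_set (coords m)) V \<and>
        homeomorphism W V \<phi> \<psi> \<and> smooth_on W \<phi> \<and> smooth_on V \<psi>)"

definition open_in :: "'a::topological_space set \<Rightarrow> 'a set \<Rightarrow> bool" where
  "open_in S W \<longleftrightarrow> openin (top_of_set S) W"

definition loc_const :: "'a::topological_space set \<Rightarrow> ('a \<Rightarrow> 'i) \<Rightarrow> bool" where
  "loc_const S c \<longleftrightarrow> (\<forall>x\<in>S. \<exists>W. open_in S W \<and> x \<in> W \<and> (\<forall>y\<in>W. c y = c x))"

definition curve_in ::
  "'a::real_normed_vector set \<Rightarrow> (real \<Rightarrow> 'a) \<Rightarrow> 'a \<Rightarrow> 'a \<Rightarrow> bool" where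
  "curve_in S \<gamma> x v \<longleftrightarrow> (\<exists>e>0. smooth_on {-e<..<e} \<gamma> \<and> \<gamma> ` {-e<..<e} \<subseteq> S) \<and> \<gamma> 0 = x \<and>
     (\<gamma> has_vector_derivative v) (at 0)"

definition tangent :: "'a::real_normed_vector set \<Rightarrow> 'a \<Rightarrow> 'a set" where
  "tangent S x = {v. \<exists>\<gamma>. curve_in S \<gamma> x v}"

text \<open>The differential of a map on \<open>S\<close>, with value \<open>0\<close> off the tangent bundle of \<open>S\<close>; the same
  convention is used for all forms below, so that forms on \<open>S\<close> are equal as functions iff they
  are equal as forms.\<close>

definition diff ::
  "'a::real_normed_vector set \<Rightarrow> ('a \<Rightarrow> 'b::real_normed_vector) \<Rightarrow> 'a \<Rightarrow> 'a \<Rightarrow> 'b" where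
  "diff S f x v = (if x \<in> S \<and> v \<in> tangent S x
     then (THE r. \<exists>\<gamma>. curve_in S \<gamma> x v \<and> ((\<lambda>t. f (\<gamma> t)) has_vector_derivative r) (at 0)) else 0)"

definition vfields :: "'a::real_normed_vector set \<Rightarrow> ('a \<Rightarrow> 'a) set" where
  "vfields S = {X. smooth_on S X \<and> (\<forall>x\<in>S. X x \<in> tangent S x)}"

definition lie_bracket ::
  "'a::real_normed_vector set \<Rightarrow> ('a \<Rightarrow> 'a) \<Rightarrow> ('a \<Rightarrow> 'a) \<Rightarrow> 'a \<Rightarrow> 'a" where
  "lie_bracket S X Y x = diff S Y x (X x) - diff S X x (Y x)"

definition linear_on_sub ::
  "'a::real_vector set \<Rightarrow> ('a \<Rightarrow> 'b::real_vector) \<Rightarrow> bool" where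
  "linear_on_sub T f \<longleftrightarrow>
     (\<forall>v\<in>T. \<forall>w\<in>T. f (v + w) = f v + f w) \<and> (\<forall>v\<in>T. \<forall>c. f (c *\<^sub>R v) = c *\<^sub>R f v)"

definition form1 ::
  "'a::real_normed_vector set \<Rightarrow> 'b::real_normed_vector set \<Rightarrow> ('a \<Rightarrow> 'a \<Rightarrow> 'b) set" where
  "form1 S V = {\<omega>.
     (\<forall>x v. \<not> (x \<in> S \<and> v \<in> tangent S x) \<longrightarrow> \<omega> x v = 0) \<and>
     (\<forall>x\<in>S. linear_on_sub (tangent S x) (\<omega> x) \<and> \<omega> x ` tangent S x \<subseteq> V) \<and>
     (\<forall>W X. open_in S W \<and> X \<in> vfields W \<longrightarrow> smooth_on W (\<lambda>x. \<omega> x (X x)))}"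

definition tensor2 :: "'a::real_normed_vector set \<Rightarrow> ('a \<Rightarrow> 'a \<Rightarrow> 'a \<Rightarrow> real) set" where
  "tensor2 S = {\<omega>.
     (\<forall>x v w. \<not> (x \<in> S \<and> v \<in> tangent S x \<and> w \<in> tangent S x) \<longrightarrow> \<omega> x v w = 0) \<and>
     (\<forall>x\<in>S. \<forall>v\<in>tangent S x.
        linear_on_sub (tangent S x) (\<omega> x v) \<and> linear_on_sub (tangent S x) (\<lambda>w. \<omega> x w v)) \<and>
     (\<forall>W X Y. open_in S W \<and> X \<in> vfields W \<and> Y \<in> vfields W \<longrightarrow> smooth_on W (\<lambda>x. \<omega> x (X x) (Y x)))}"

definition form2 :: "'a::real_normed_vector set \<Rightarrow> ('a \<Rightarrow> 'a \<Rightarrow> 'a \<Rightarrow> real) set" where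
  "form2 S = {\<omega> \<in> tensor2 S. \<forall>x v. \<omega> x v v = 0}"

text \<open>Exterior derivatives by the Koszul formula for local extensions of the arguments to vector
  fields.\<close>

definition ext_d1 ::
  "'a::real_normed_vector set \<Rightarrow> ('a \<Rightarrow> 'a \<Rightarrow> 'b::real_normed_vector) \<Rightarrow> 'a \<Rightarrow> 'a \<Rightarrow> 'a \<Rightarrow> 'b" where
  "ext_d1 S \<omega> x v w = (if x \<in> S \<and> v \<in> tangent S x \<and> w \<in> tangent S x
     then (THE r. \<exists>W X Y. open_in S W \<and> x \<in> W \<and> X \<in> vfields W \<and> Y \<in> vfields W \<and> X x = v \<and> Y x = w \<and>
        r = diff W (\<lambda>y. \<omega> y (Y y)) x v - diff W (\<lambda>y. \<omega> y (X y)) x w - \<omega> x (lie_bracket W X Y x))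
     else 0)"

definition ext_d2 ::
  "'a::real_normed_vector set \<Rightarrow> ('a \<Rightarrow> 'a \<Rightarrow> 'a \<Rightarrow> real) \<Rightarrow> 'a \<Rightarrow> 'a \<Rightarrow> 'a \<Rightarrow> 'a \<Rightarrow> real" where
  "ext_d2 S \<omega> x u v w = (if x \<in> S \<and> u \<in> tangent S x \<and> v \<in> tangent S x \<and> w \<in> tangent S x
     then (THE r. \<exists>W X Y Z. open_in S W \<and> x \<in> W \<and>
        X \<in> vfields W \<and> Y \<in> vfields W \<and> Z \<in> vfields W \<and> X x = u \<and> Y x = v \<and> Z x = w \<and>
        r = diff W (\<lambda>y. \<omega> y (Y y) (Z y)) x u - diff W (\<lambda>y. \<omega> y (X y) (Z y)) x v
          + diff W (\<lambda>y. \<omega> y (X y) (Y y)) x w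
          - \<omega> x (lie_bracket W X Y x) w + \<omega> x (lie_bracket W X Z x) v - \<omega> x (lie_bracket W Y Z x) u)
     else 0)"

definition pull1 where
  "pull1 S h \<omega> = (\<lambda>x v. \<omega> (h x) (diff S h x v))"

definition pull2 where
  "pull2 S h \<omega> = (\<lambda>x v w. \<omega> (h x) (diff S h x v) (diff S h x w))"

text \<open>\<open>U(1)\<close> is the unit circle, a real number \<open>a\<close> modulo \<open>\<int>\<close> corresponding to \<open>exp (2 \<pi> i a)\<close>;
  additive formulas for \<open>U(1)\<close> become multiplicative. If \<open>f = exp (2 \<pi> i a)\<close> with a real lift \<open>a\<close>,
  then \<open>da = df / (2 \<pi> i f)\<close>.\<close>

definition U1fun :: "'a::real_normed_vector set \<Rightarrow> ('a \<Rightarrow> complex) set" where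
  "U1fun S = {f \<in> extensional S. smooth_on S f \<and> (\<forall>x\<in>S. cmod (f x) = 1)}"

definition dlog :: "'a::real_normed_vector set \<Rightarrow> ('a \<Rightarrow> complex) \<Rightarrow> 'a \<Rightarrow> 'a \<Rightarrow> real" where
  "dlog S f x v = Re (diff S f x v / (2 * of_real pi * \<i> * f x))"

section \<open>Spin groups\<close>

text \<open>The real Clifford algebra on orthonormal generators \<open>e i\<close> with \<open>e i ^ 2 = -1\<close>; the basis
  element indexed by a finite set \<open>A\<close> is the product of the \<open>e i\<close>, \<open>i \<in> A\<close>, in increasing order.\<close>

type_synonym cl = "nat set \<Rightarrow>\<^sub>0 real"

definition cl_sign :: "nat set \<Rightarrow> nat set \<Rightarrow> real" where
  "cl_sign A B = (-1) ^ (card {(a, b). a \<in> A \<and> b \<in> B \<and> b < a} + card (A \<inter> B))"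

definition cl_mult :: "cl \<Rightarrow> cl \<Rightarrow> cl" (infixl \<open>\<odot>\<close> 70) where
  "x \<odot> y = (\<Sum>A\<in>Poly_Mapping.keys x. \<Sum>B\<in>Poly_Mapping.keys y.
     Poly_Mapping.single ((A - B) \<union> (B - A))
       (cl_sign A B * Poly_Mapping.lookup x A * Poly_Mapping.lookup y B))"

definition cl_one :: cl where
  "cl_one = Poly_Mapping.single {} 1"

definition cl_inv :: "cl \<Rightarrow> cl" where
  "cl_inv x = (THE y. x \<odot> y = cl_one \<and> y \<odot> x = cl_one)"

definition cl_vectors :: "nat \<Rightarrow> cl set" where
  "cl_vectors n = {v. Poly_Mapping.keys v \<subseteq> (\<lambda>i. {i}) ` {..<n}}"

definition Spin :: "nat \<Rightarrow> cl set" where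
  "Spin n = {foldr (\<odot>) vs cl_one |vs. set vs \<subseteq> {v \<in> cl_vectors n. norm v = 1} \<and> even (length vs)}"

text \<open>The Lie algebra of \<open>Spin n\<close>, i.e. \<open>\<ss>\<oo>(n)\<close>, consists of the bivectors; it acts on \<open>\<real>\<^sup>n\<close> by
  commutators.\<close>

definition so_alg :: "nat \<Rightarrow> cl set" where
  "so_alg n = {a. Poly_Mapping.keys a \<subseteq> {A. A \<subseteq> {..<n} \<and> card A = 2}}"

definition cl_bracket :: "cl \<Rightarrow> cl \<Rightarrow> cl" where
  "cl_bracket a b = a \<odot> b - b \<odot> a"

definition Ad :: "cl \<Rightarrow> cl \<Rightarrow> cl" where
  "Ad g a = g \<odot> a \<odot> cl_inv g"

text \<open>By Chern--Weil theory \<open>p\<^sub>1\<close> is the real class of \<open>- tr (R\<^sup>2) / (8 \<pi>\<^sup>2)\<close>, the trace being that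
  of the action on \<open>\<real>\<^sup>n\<close>; hence the normalisation below makes \<open>(R,R)\<close> represent half of \<open>p\<^sub>1\<close>.\<close>

definition ip :: "nat \<Rightarrow> cl \<Rightarrow> cl \<Rightarrow> real" where
  "ip n a b = - (1 / (16 * pi\<^sup>2)) *
     (\<Sum>i<n. Poly_Mapping.lookup (cl_bracket a (cl_bracket b (Poly_Mapping.single {i} 1))) {i})"

text \<open>Pullback of the right-invariant Maurer--Cartan form along \<open>h : S \<rightarrow> Spin n\<close>.\<close>

definition mc :: "'a::real_normed_vector set \<Rightarrow> ('a \<Rightarrow> cl) \<Rightarrow> 'a \<Rightarrow> 'a \<Rightarrow> cl" where
  "mc S h x v = diff S h x v \<odot> cl_inv (h x)"

text \<open>\<open>cs\<^sub>3 \<theta> = (\<theta>, d\<theta>) + (\<theta>, [\<theta>, \<theta>]) / 3\<close>, where \<open>[\<theta>, \<theta>](v, w) = 2 [\<theta> v, \<theta> w]\<close> and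
  \<open>(\<alpha>, \<beta>)(u, v, w) = (\<alpha> u, \<beta>(v, w)) + (\<alpha> v, \<beta>(w, u)) + (\<alpha> w, \<beta>(u, v))\<close>.\<close>

definition wedge12 ::
  "nat \<Rightarrow> ('a \<Rightarrow> 'a \<Rightarrow> cl) \<Rightarrow> ('a \<Rightarrow> 'a \<Rightarrow> 'a \<Rightarrow> cl) \<Rightarrow> 'a \<Rightarrow> 'a \<Rightarrow> 'a \<Rightarrow> 'a \<Rightarrow> real" where
  "wedge12 n \<alpha> \<beta> x u v w =
     ip n (\<alpha> x u) (\<beta> x v w) + ip n (\<alpha> x v) (\<beta> x w u) + ip n (\<alpha> x w) (\<beta> x u v)"

definition bracket_form :: "('a \<Rightarrow> 'a \<Rightarrow> cl) \<Rightarrow> 'a \<Rightarrow> 'a \<Rightarrow> 'a \<Rightarrow> cl" where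
  "bracket_form \<theta> x v w = 2 *\<^sub>R cl_bracket (\<theta> x v) (\<theta> x w)"

definition cs3 ::
  "nat \<Rightarrow> 'a::real_normed_vector set \<Rightarrow> ('a \<Rightarrow> 'a \<Rightarrow> cl) \<Rightarrow> 'a \<Rightarrow> 'a \<Rightarrow> 'a \<Rightarrow> 'a \<Rightarrow> real" where
  "cs3 n S \<theta> x u v w =
     wedge12 n \<theta> (ext_d1 S \<theta>) x u v w + (1 / 3) * wedge12 n \<theta> (bracket_form \<theta>) x u v w"

section \<open>The Lie 2-group String(n)\<close>

text \<open>The simplicial manifold \<open>BG\<close> for \<open>G = Spin n\<close>: the level \<open>k\<close> is \<open>G\<^sup>k\<close>.\<close>

type_synonym bg = "nat \<Rightarrow>\<^sub>0 cl"

definition tup :: "cl list \<Rightarrow> bg" where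
  "tup gs = (\<Sum>i<length gs. Poly_Mapping.single i (gs ! i))"

definition BG :: "nat \<Rightarrow> nat \<Rightarrow> bg set" where
  "BG n k = {tup gs |gs. length gs = k \<and> set gs \<subseteq> Spin n}"

definition bg_face :: "nat \<Rightarrow> nat \<Rightarrow> bg \<Rightarrow> bg" where
  "bg_face k j x = tup (map (\<lambda>i.
     if i + 1 < j then Poly_Mapping.lookup x i
     else if i + 1 = j then Poly_Mapping.lookup x i \<odot> Poly_Mapping.lookup x (i + 1)
     else Poly_Mapping.lookup x (i + 1)) [0..<k - 1])"

text \<open>A hypercover of \<open>BG\<close> together with a Cech cochain \<open>(\<Theta>, \<Psi>, \<eta>, 0)\<close>. Only the face maps of the
  hypercover are used.\<close>

record 'i presentation =
  Idx :: "nat \<Rightarrow> 'i set"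
  face :: "nat \<Rightarrow> nat \<Rightarrow> 'i \<Rightarrow> 'i"
  chart :: "nat \<Rightarrow> 'i \<Rightarrow> bg set"
  Theta :: "'i \<Rightarrow> bg \<Rightarrow> complex"
  Psi :: "'i \<Rightarrow> 'i \<Rightarrow> bg \<Rightarrow> complex"
  eta :: "'i \<Rightarrow> 'i \<Rightarrow> 'i \<Rightarrow> bg \<Rightarrow> complex"

text \<open>The third condition is the hypercover condition: level \<open>k\<close> covers the \<open>k\<close>-th matching object.
  The last one is goodness.\<close>

definition good_hypercover :: "nat \<Rightarrow> 'i presentation \<Rightarrow> bool" where
  "good_hypercover n S \<longleftrightarrow>
     (\<forall>k. \<forall>a\<in>Idx S k. open_in (BG n k) (chart S k a)) \<and>
     (\<forall>k\<ge>1. \<forall>j\<le>k. \<forall>a\<in>Idx S k. face S k j a \<in> Idx S (k - 1) \<and>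
        bg_face k j ` chart S k a \<subseteq> chart S (k - 1) (face S k j a)) \<and>
     (\<forall>k\<ge>2. \<forall>a\<in>Idx S k. \<forall>j\<le>k. \<forall>i<j.
        face S (k - 1) i (face S k j a) = face S (k - 1) (j - 1) (face S k i a)) \<and>
     BG n 0 \<subseteq> (\<Union>a\<in>Idx S 0. chart S 0 a) \<and>
     (\<forall>k\<ge>1. \<forall>b x. (\<forall>j\<le>k. b j \<in> Idx S (k - 1)) \<and>
        (k \<ge> 2 \<longrightarrow> (\<forall>j\<le>k. \<forall>i<j. face S (k - 1) i (b j) = face S (k - 1) (j - 1) (b i))) \<and>
        x \<in> BG n k \<and> (\<forall>j\<le>k. bg_face k j x \<in> chart S (k - 1) (b j)) \<longrightarrow>
        (\<exists>a\<in>Idx S k. x \<in> chart S k a \<and> (\<forall>j\<le>k. face S k j a = b j))) \<and>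
     (\<forall>k F. finite F \<and> F \<noteq> {} \<and> F \<subseteq> Idx S k \<and> (\<Inter>a\<in>F. chart S k a) \<noteq> {} \<longrightarrow>
        contractible (\<Inter>a\<in>F. chart S k a))"

definition U1_on :: "'a::real_normed_vector set \<Rightarrow> ('a \<Rightarrow> complex) \<Rightarrow> bool" where
  "U1_on W f \<longleftrightarrow> smooth_on W f \<and> (\<forall>x\<in>W. cmod (f x) = 1)"

text \<open>The cocycle condition in the total complex with differential
  \<open>\<delta>_simplicial + (-1)^p \<delta>_Cech\<close> (\<open>p\<close> the simplicial degree).\<close>

definition string_cocycle :: "nat \<Rightarrow> 'i presentation \<Rightarrow> bool" where
  "string_cocycle n S \<longleftrightarrow>
     (\<forall>a\<in>Idx S 1. \<forall>b\<in>Idx S 1. \<forall>c\<in>Idx S 1.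
        U1_on (chart S 1 a \<inter> chart S 1 b \<inter> chart S 1 c) (eta S a b c)) \<and>
     (\<forall>a\<in>Idx S 2. \<forall>b\<in>Idx S 2. U1_on (chart S 2 a \<inter> chart S 2 b) (Psi S a b)) \<and>
     (\<forall>a\<in>Idx S 3. U1_on (chart S 3 a) (Theta S a)) \<and>
     (\<forall>a\<in>Idx S 1. \<forall>b\<in>Idx S 1. \<forall>c\<in>Idx S 1. \<forall>e\<in>Idx S 1.
        \<forall>x\<in>chart S 1 a \<inter> chart S 1 b \<inter> chart S 1 c \<inter> chart S 1 e.
          eta S b c e x * eta S a b e x = eta S a c e x * eta S a b c x) \<and>
     (\<forall>a\<in>Idx S 2. \<forall>b\<in>Idx S 2. \<forall>c\<in>Idx S 2. \<forall>x\<in>chart S 2 a \<inter> chart S 2 b \<inter> chart S 2 c.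
        (\<Prod>j\<le>2. eta S (face S 2 j a) (face S 2 j b) (face S 2 j c) (bg_face 2 j x) powi ((-1) ^ j))
          * (Psi S b c x / Psi S a c x * Psi S a b x) = 1) \<and>
     (\<forall>a\<in>Idx S 3. \<forall>b\<in>Idx S 3. \<forall>x\<in>chart S 3 a \<inter> chart S 3 b.
        (\<Prod>j\<le>3. Psi S (face S 3 j a) (face S 3 j b) (bg_face 3 j x) powi ((-1) ^ j))
          = Theta S b x / Theta S a x) \<and>
     (\<forall>a\<in>Idx S 4. \<forall>x\<in>chart S 4 a.
        (\<Prod>j\<le>4. Theta S (face S 4 j a) (bg_face 4 j x) powi ((-1) ^ j)) = 1)"

text \<open>The cocycle represents half of \<open>p\<^sub>1\<close>. For \<open>n \<ge> 3\<close> the group \<open>H\<^sup>4(BSpin(n), \<int>)\<close> is torsion free, so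
  this is a condition on the real class, which by Chern--Weil theory is given in the simplicial
  de Rham complex by the Bott--Shulman form
  \<open>- (\<theta>, [\<theta>, \<theta>]) / 6\<close> on \<open>G\<close> and \<open>(pr\<^sub>1\<^sup>* \<theta>\<^sup>L \<and> pr\<^sub>2\<^sup>* \<theta>)\<close> on \<open>G\<^sup>2\<close> (\<open>\<theta>\<close> and \<open>\<theta>\<^sup>L\<close> the right- and left-invariant
  Maurer--Cartan forms). The condition says that the cocycle lifts to a Deligne cocycle
  \<open>(\<Theta>, \<Psi>, \<eta>, a, A, B)\<close> with this form as curvature. The signs are those for which pulling back
  \<open>B\<close>, \<open>a\<close> and \<open>\<Theta>\<close> along a \<open>G\<close>-cocycle solves the equations
  \<open>d\<omega>\<^sup>2 = \<delta> cs\<^sub>3\<close>, \<open>\<delta>\<omega>\<^sup>2 = - d\<omega>\<^sup>1\<close>, \<open>\<delta>\<omega>\<^sup>1 = dlog \<Theta>\<close> of string data.\<close>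

definition bg_right_mc :: "nat \<Rightarrow> bg \<Rightarrow> bg \<Rightarrow> cl" where
  "bg_right_mc i x v = Poly_Mapping.lookup v i \<odot> cl_inv (Poly_Mapping.lookup x i)"

definition bg_left_mc :: "nat \<Rightarrow> bg \<Rightarrow> bg \<Rightarrow> cl" where
  "bg_left_mc i x v = cl_inv (Poly_Mapping.lookup x i) \<odot> Poly_Mapping.lookup v i"

definition represents_half_p1 :: "nat \<Rightarrow> 'i presentation \<Rightarrow> bool" where
  "represents_half_p1 n S \<longleftrightarrow> (\<exists>B A a.
     (\<forall>p\<in>Idx S 1. B p \<in> form2 (chart S 1 p)) \<and>
     (\<forall>p\<in>Idx S 1. \<forall>q\<in>Idx S 1. A p q \<in> form1 (chart S 1 p \<inter> chart S 1 q) (UNIV :: real set)) \<and>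
     (\<forall>c\<in>Idx S 2. a c \<in> form1 (chart S 2 c) (UNIV :: real set)) \<and>
     (\<forall>p\<in>Idx S 1. \<forall>x\<in>chart S 1 p.
        \<forall>u\<in>tangent (BG n 1) x. \<forall>v\<in>tangent (BG n 1) x. \<forall>w\<in>tangent (BG n 1) x.
          ext_d2 (chart S 1 p) (B p) x u v w =
            - (1 / 6) * wedge12 n (bg_right_mc 0) (bracket_form (bg_right_mc 0)) x u v w) \<and>
     (\<forall>p\<in>Idx S 1. \<forall>q\<in>Idx S 1. \<forall>x\<in>chart S 1 p \<inter> chart S 1 q.
        \<forall>v\<in>tangent (BG n 1) x. \<forall>w\<in>tangent (BG n 1) x.
          B q x v w - B p x v w = - ext_d1 (chart S 1 p \<inter> chart S 1 q) (A p q) x v w) \<and>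
     (\<forall>p\<in>Idx S 1. \<forall>q\<in>Idx S 1. \<forall>r\<in>Idx S 1. \<forall>x\<in>chart S 1 p \<inter> chart S 1 q \<inter> chart S 1 r.
        \<forall>v\<in>tangent (BG n 1) x.
          A q r x v - A p r x v + A p q x v =
            dlog (chart S 1 p \<inter> chart S 1 q \<inter> chart S 1 r) (eta S p q r) x v) \<and>
     (\<forall>c\<in>Idx S 2. \<forall>x\<in>chart S 2 c. \<forall>v\<in>tangent (BG n 2) x. \<forall>w\<in>tangent (BG n 2) x.
        (\<Sum>j\<le>2. (-1) ^ j * pull2 (chart S 2 c) (bg_face 2 j) (B (face S 2 j c)) x v w)
          + (ip n (bg_left_mc 0 x v) (bg_right_mc 1 x w) - ip n (bg_left_mc 0 x w) (bg_right_mc 1 x v))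
        = - ext_d1 (chart S 2 c) (a c) x v w) \<and>
     (\<forall>c\<in>Idx S 2. \<forall>e\<in>Idx S 2. \<forall>x\<in>chart S 2 c \<inter> chart S 2 e. \<forall>v\<in>tangent (BG n 2) x.
        a e x v - a c x v = dlog (chart S 2 c \<inter> chart S 2 e) (Psi S c e) x v
          + (\<Sum>j\<le>2. (-1) ^ j * pull1 (chart S 2 c \<inter> chart S 2 e) (bg_face 2 j)
                               (A (face S 2 j c) (face S 2 j e)) x v)) \<and>
     (\<forall>t\<in>Idx S 3. \<forall>x\<in>chart S 3 t. \<forall>v\<in>tangent (BG n 3) x.
        (\<Sum>j\<le>3. (-1) ^ j * pull1 (chart S 3 t) (bg_face 3 j) (a (face S 3 j t)) x v)
          = dlog (chart S 3 t) (Theta S t) x v))"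

definition string_presentation :: "nat \<Rightarrow> 'i presentation \<Rightarrow> bool" where
  "string_presentation n S \<longleftrightarrow> good_hypercover n S \<and> string_cocycle n S \<and> represents_half_p1 n S"

text \<open>Trivialised principal \<open>\<Gamma>[\<eta>]\<close>-bundles over \<open>U\<close> are smooth maps \<open>U \<rightarrow> \<Gamma>\<^sub>0 = \<Squnion> chart \<alpha>\<close>, i.e. pairs of
  a smooth map to \<open>G\<close> and a locally constant index. An isomorphism between two of them with the
  same map \<open>g\<close> to \<open>G\<close> and indices \<open>\<alpha>\<close>, \<open>\<beta>\<close> is an arrow \<open>(g, a)\<close> of \<open>\<Gamma>[\<eta>]\<close> over the chart overlap, i.e. a
  \<open>U(1)\<close>-valued function \<open>a\<close>.\<close>

definition string_maps :: "nat \<Rightarrow> 'i presentation \<Rightarrow> rvec set \<Rightarrow> (rvec \<Rightarrow> cl \<times> 'i) set" where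
  "string_maps n S U = {g \<in> extensional U.
     smooth_on U (\<lambda>x. fst (g x)) \<and> loc_const U (\<lambda>x. snd (g x)) \<and>
     (\<forall>x\<in>U. fst (g x) \<in> Spin n \<and> snd (g x) \<in> Idx S 1 \<and> tup [fst (g x)] \<in> chart S 1 (snd (g x)))}"

definition arr_comp :: "'i presentation \<Rightarrow> cl \<Rightarrow> 'i \<Rightarrow> 'i \<Rightarrow> 'i \<Rightarrow> complex \<Rightarrow> complex \<Rightarrow> complex" where
  "arr_comp S g \<alpha> \<beta> \<gamma> a b = a * b / eta S \<alpha> \<beta> \<gamma> (tup [g])"

definition arr_unit :: "'i presentation \<Rightarrow> cl \<times> 'i \<Rightarrow> complex" where
  "arr_unit S g = eta S (snd g) (snd g) (snd g) (tup [fst g])"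

text \<open>A trivialisation of the product \<open>g h\<close> of two trivialised bundles with indices \<open>\<alpha>\<close>, \<open>\<beta>\<close> is given by
  \<open>c \<in> Idx 2\<close> with \<open>d\<^sub>2 c = \<alpha>\<close>, \<open>d\<^sub>0 c = \<beta>\<close>; the product bundle then has index \<open>d\<^sub>1 c\<close>.\<close>

definition product_triv ::
  "'i presentation \<Rightarrow> rvec set \<Rightarrow> (rvec \<Rightarrow> cl \<times> 'i) \<Rightarrow> (rvec \<Rightarrow> cl \<times> 'i) \<Rightarrow> (rvec \<Rightarrow> 'i) set" where
  "product_triv S U g h = {c \<in> extensional U. loc_const U c \<and>
     (\<forall>x\<in>U. c x \<in> Idx S 2 \<and> tup [fst (g x), fst (h x)] \<in> chart S 2 (c x) \<and>
        face S 2 2 (c x) = snd (g x) \<and> face S 2 0 (c x) = snd (h x))}"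

text \<open>The product of arrows, from the product trivialised by \<open>c\<close> to the one trivialised by \<open>e\<close>.\<close>

definition arr_prod ::
  "'i presentation \<Rightarrow> cl \<Rightarrow> cl \<Rightarrow> 'i \<Rightarrow> 'i \<Rightarrow> complex \<Rightarrow> complex \<Rightarrow> complex" where
  "arr_prod S g h c e a b = a * b * Psi S c e (tup [g, h])"

text \<open>The associator \<open>(g h) k \<Rightarrow> g (h k)\<close>. With \<open>t \<in> Idx 3\<close>, the left-hand side is trivialised by \<open>d\<^sub>3 t\<close>
  and \<open>d\<^sub>1 t\<close>, the right-hand side by \<open>d\<^sub>0 t\<close> and \<open>d\<^sub>2 t\<close>, both having index \<open>d\<^sub>1 (d\<^sub>1 t) = d\<^sub>1 (d\<^sub>2 t)\<close>.
  The second function is the inverse arrow.\<close>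

definition assoc_idx :: "'i presentation \<Rightarrow> 'i \<Rightarrow> 'i" where
  "assoc_idx S t = face S 2 1 (face S 3 1 t)"

definition assoc_arr :: "'i presentation \<Rightarrow> cl \<Rightarrow> cl \<Rightarrow> cl \<Rightarrow> 'i \<Rightarrow> complex" where
  "assoc_arr S g h k t = Theta S t (tup [g, h, k]) * arr_unit S (g \<odot> h \<odot> k, assoc_idx S t)"

definition assoc_inv :: "'i presentation \<Rightarrow> cl \<Rightarrow> cl \<Rightarrow> cl \<Rightarrow> 'i \<Rightarrow> complex" where
  "assoc_inv S g h k t = arr_unit S (g \<odot> h \<odot> k, assoc_idx S t) / Theta S t (tup [g, h, k])"

section \<open>String data\<close>

definition open_cover :: "rvec set \<Rightarrow> nat set \<Rightarrow> (nat \<Rightarrow> rvec set) \<Rightarrow> bool" where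
  "open_cover M I U \<longleftrightarrow> U \<in> extensional I \<and> (\<forall>i\<in>I. open_in M (U i)) \<and> (\<Union>i\<in>I. U i) = M"

record 'i string_obj =
  so_idx :: "nat set"
  so_cov :: "nat \<Rightarrow> rvec set"
  so_th :: "nat \<Rightarrow> rvec \<Rightarrow> rvec \<Rightarrow> cl"
  so_B :: "nat \<Rightarrow> rvec \<Rightarrow> rvec \<Rightarrow> rvec \<Rightarrow> real"
  so_g :: "nat \<times> nat \<Rightarrow> rvec \<Rightarrow> cl \<times> 'i"
  so_A :: "nat \<times> nat \<Rightarrow> rvec \<Rightarrow> rvec \<Rightarrow> real"
  so_om2 :: "nat \<times> nat \<Rightarrow> rvec \<Rightarrow> rvec \<Rightarrow> rvec \<Rightarrow> real"
  so_c :: "nat \<times> nat \<times> nat \<Rightarrow> rvec \<Rightarrow> 'i"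
  so_f :: "nat \<times> nat \<times> nat \<Rightarrow> rvec \<Rightarrow> complex"
  so_om1 :: "nat \<times> nat \<times> nat \<Rightarrow> rvec \<Rightarrow> rvec \<Rightarrow> real"

abbreviation U2 :: "(nat \<Rightarrow> rvec set) \<Rightarrow> nat \<Rightarrow> nat \<Rightarrow> rvec set" where
  "U2 U i j \<equiv> U i \<inter> U j"

abbreviation U3 :: "(nat \<Rightarrow> rvec set) \<Rightarrow> nat \<Rightarrow> nat \<Rightarrow> nat \<Rightarrow> rvec set" where
  "U3 U i j k \<equiv> U i \<inter> U j \<inter> U k"

text \<open>The component \<open>so_c\<close> trivialises the products \<open>g\<^sub>i\<^sub>j g\<^sub>j\<^sub>k\<close>, so that the isomorphisms
  \<open>f\<^sub>i\<^sub>j\<^sub>k : g\<^sub>i\<^sub>k \<Rightarrow> g\<^sub>i\<^sub>j g\<^sub>j\<^sub>k\<close> become \<open>U(1)\<close>-valued functions. The pentagon condition equates the arrows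
  \<open>g\<^sub>i\<^sub>l \<Rightarrow> g\<^sub>i\<^sub>j g\<^sub>j\<^sub>l \<Rightarrow> g\<^sub>i\<^sub>j (g\<^sub>j\<^sub>k g\<^sub>k\<^sub>l)\<close> and \<open>g\<^sub>i\<^sub>l \<Rightarrow> g\<^sub>i\<^sub>k g\<^sub>k\<^sub>l \<Rightarrow> (g\<^sub>i\<^sub>j g\<^sub>j\<^sub>k) g\<^sub>k\<^sub>l \<Rightarrow> g\<^sub>i\<^sub>j (g\<^sub>j\<^sub>k g\<^sub>k\<^sub>l)\<close>; if the indices
  match it says that the Cech differential of \<open>f\<close> is \<open>\<Theta>\<close>.\<close>

definition pentagon :: "nat \<Rightarrow> 'i presentation \<Rightarrow> 'i string_obj \<Rightarrow> bool" where
  "pentagon n S P \<longleftrightarrow> (\<forall>i\<in>so_idx P. \<forall>j\<in>so_idx P. \<forall>k\<in>so_idx P. \<forall>l\<in>so_idx P.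
     \<forall>x\<in>so_cov P i \<inter> so_cov P j \<inter> so_cov P k \<inter> so_cov P l. \<forall>t\<in>Idx S 3.
     (let gij = so_g P (i, j) x; gjk = so_g P (j, k) x; gkl = so_g P (k, l) x;
          gik = so_g P (i, k) x; gjl = so_g P (j, l) x; gil = so_g P (i, l) x;
          cijk = so_c P (i, j, k) x; cjkl = so_c P (j, k, l) x;
          cikl = so_c P (i, k, l) x; cijl = so_c P (i, j, l) x;
          d = face S 3 1 t; e = face S 3 2 t
      in tup [fst gij, fst gjk, fst gkl] \<in> chart S 3 t \<and> face S 3 3 t = cijk \<and> face S 3 0 t = cjkl \<longrightarrow>
         arr_comp S (fst gil) (snd gil) (face S 2 1 cijl) (face S 2 1 e)
           (so_f P (i, j, l) x)
           (arr_prod S (fst gij) (fst gjl) cijl e (arr_unit S gij) (so_f P (j, k, l) x)) =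
         arr_comp S (fst gil) (snd gil) (face S 2 1 d) (face S 2 1 e)
           (arr_comp S (fst gil) (snd gil) (face S 2 1 cikl) (face S 2 1 d)
              (so_f P (i, k, l) x)
              (arr_prod S (fst gik) (fst gkl) cikl d (so_f P (i, j, k) x) (arr_unit S gkl)))
           (assoc_arr S (fst gij) (fst gjk) (fst gkl) t)))"

definition string_objs :: "nat \<Rightarrow> 'i presentation \<Rightarrow> rvec set \<Rightarrow> 'i string_obj set" where
  "string_objs n S M = {P.
     (let I = so_idx P; U = so_cov P; \<theta> = so_th P; B = so_B P; g = so_g P; A = so_A P;
          \<omega>2 = so_om2 P; c = so_c P; f = so_f P; \<omega>1 = so_om1 P
      in open_cover M I U \<and>
         \<theta> \<in> (\<Pi>\<^sub>E i\<in>I. form1 (U i) (so_alg n)) \<and>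
         B \<in> (\<Pi>\<^sub>E i\<in>I. form2 (U i)) \<and>
         g \<in> (\<Pi>\<^sub>E (i, j)\<in>I \<times> I. string_maps n S (U2 U i j)) \<and>
         A \<in> (\<Pi>\<^sub>E (i, j)\<in>I \<times> I. form1 (U2 U i j) UNIV) \<and>
         \<omega>2 \<in> (\<Pi>\<^sub>E (i, j)\<in>I \<times> I. form2 (U2 U i j)) \<and>
         c \<in> (\<Pi>\<^sub>E (i, j, k)\<in>I \<times> I \<times> I. product_triv S (U3 U i j k) (g (i, j)) (g (j, k))) \<and>
         f \<in> (\<Pi>\<^sub>E (i, j, k)\<in>I \<times> I \<times> I. U1fun (U3 U i j k)) \<and>
         \<omega>1 \<in> (\<Pi>\<^sub>E (i, j, k)\<in>I \<times> I \<times> I. form1 (U3 U i j k) UNIV) \<and>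
         (\<forall>i\<in>I. \<forall>j\<in>I. \<forall>x\<in>U2 U i j.
            (\<forall>v w. B j x v w - B i x v w = ext_d1 (U2 U i j) (A (i, j)) x v w + \<omega>2 (i, j) x v w) \<and>
            (\<forall>u v w. cs3 n (U2 U i j) (\<theta> j) x u v w - cs3 n (U2 U i j) (\<theta> i) x u v w
                        = ext_d2 (U2 U i j) (\<omega>2 (i, j)) x u v w) \<and>
            (\<forall>v. \<theta> i x v - Ad (fst (g (i, j) x)) (\<theta> j x v)
                        = - mc (U2 U i j) (\<lambda>y. fst (g (i, j) y)) x v)) \<and>
         (\<forall>i\<in>I. \<forall>j\<in>I. \<forall>k\<in>I. \<forall>x\<in>U3 U i j k.
            fst (g (i, k) x) = fst (g (i, j) x) \<odot> fst (g (j, k) x) \<and>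
            (\<forall>v. A (j, k) x v - A (i, k) x v + A (i, j) x v
                        = \<omega>1 (i, j, k) x v - dlog (U3 U i j k) (f (i, j, k)) x v) \<and>
            (\<forall>v w. \<omega>2 (j, k) x v w - \<omega>2 (i, k) x v w + \<omega>2 (i, j) x v w
                        = - ext_d1 (U3 U i j k) (\<omega>1 (i, j, k)) x v w)) \<and>
         pentagon n S P)}"

text \<open>A common refinement of two covers \<open>U\<close>, \<open>U'\<close>, i.e. a cover of the canonical common refinement
  \<open>{U i \<inter> U' j}\<close> (rather than only of \<open>M\<close>).\<close>

definition common_refinement ::
  "rvec set \<Rightarrow> nat set \<Rightarrow> (nat \<Rightarrow> rvec set) \<Rightarrow> nat set \<Rightarrow> (nat \<Rightarrow> rvec set) \<Rightarrow>
   nat set \<Rightarrow> (nat \<Rightarrow> rvec set) \<Rightarrow> (nat \<Rightarrow> nat) \<Rightarrow> (nat \<Rightarrow> nat) \<Rightarrow> bool" where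
  "common_refinement M I U I' U' J W r s \<longleftrightarrow>
     W \<in> extensional J \<and> r \<in> J \<rightarrow>\<^sub>E I \<and> s \<in> J \<rightarrow>\<^sub>E I' \<and> (\<forall>q\<in>J. open_in M (W q)) \<and>
     (\<forall>i\<in>I. \<forall>j\<in>I'. U i \<inter> U' j = (\<Union>q\<in>{q \<in> J. r q = i \<and> s q = j}. W q))"

text \<open>1-morphisms from the string data \<open>Q\<close> (the tilded data) to \<open>P\<close>. The refinement maps are \<open>sm_src\<close>
  to the cover of \<open>Q\<close> and \<open>sm_tgt\<close> to that of \<open>P\<close>; the components \<open>sm_cl\<close> and \<open>sm_cr\<close> trivialise the
  source and target products of \<open>f\<^sub>i\<^sub>j : g\<^sub>i g~\<^sub>i\<^sub>j \<Rightarrow> g\<^sub>i\<^sub>j g\<^sub>j\<close>.\<close>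

record 'i string_mor =
  sm_idx :: "nat set"
  sm_cov :: "nat \<Rightarrow> rvec set"
  sm_src :: "nat \<Rightarrow> nat"
  sm_tgt :: "nat \<Rightarrow> nat"
  sm_g :: "nat \<Rightarrow> rvec \<Rightarrow> cl \<times> 'i"
  sm_A :: "nat \<Rightarrow> rvec \<Rightarrow> rvec \<Rightarrow> real"
  sm_om2 :: "nat \<Rightarrow> rvec \<Rightarrow> rvec \<Rightarrow> rvec \<Rightarrow> real"
  sm_cl :: "nat \<times> nat \<Rightarrow> rvec \<Rightarrow> 'i"
  sm_cr :: "nat \<times> nat \<Rightarrow> rvec \<Rightarrow> 'i"
  sm_f :: "nat \<times> nat \<Rightarrow> rvec \<Rightarrow> complex"
  sm_om1 :: "nat \<times> nat \<Rightarrow> rvec \<Rightarrow> rvec \<Rightarrow> real"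

text \<open>The coherence condition equates the composites
  \<open>g\<^sub>i g~\<^sub>i\<^sub>k \<Rightarrow> g\<^sub>i (g~\<^sub>i\<^sub>j g~\<^sub>j\<^sub>k) \<Rightarrow> (g\<^sub>i g~\<^sub>i\<^sub>j) g~\<^sub>j\<^sub>k \<Rightarrow> (g\<^sub>i\<^sub>j g\<^sub>j) g~\<^sub>j\<^sub>k \<Rightarrow> g\<^sub>i\<^sub>j (g\<^sub>j g~\<^sub>j\<^sub>k) \<Rightarrow> g\<^sub>i\<^sub>j (g\<^sub>j\<^sub>k g\<^sub>k) \<Rightarrow> (g\<^sub>i\<^sub>j g\<^sub>j\<^sub>k) g\<^sub>k\<close>
  (accumulated in \<open>a1\<close>, ..., \<open>a6\<close>) and \<open>g\<^sub>i g~\<^sub>i\<^sub>k \<Rightarrow> g\<^sub>i\<^sub>k g\<^sub>k \<Rightarrow> (g\<^sub>i\<^sub>j g\<^sub>j\<^sub>k) g\<^sub>k\<close>.\<close>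

definition mor_coherence ::
  "nat \<Rightarrow> 'i presentation \<Rightarrow> 'i string_obj \<Rightarrow> 'i string_obj \<Rightarrow> 'i string_mor \<Rightarrow> bool" where
  "mor_coherence n S Q P m \<longleftrightarrow> (\<forall>i\<in>sm_idx m. \<forall>j\<in>sm_idx m. \<forall>k\<in>sm_idx m.
     \<forall>x\<in>U3 (sm_cov m) i j k. \<forall>t\<in>Idx S 3. \<forall>t'\<in>Idx S 3. \<forall>t''\<in>Idx S 3.
     (let si = sm_src m i; sj = sm_src m j; sk = sm_src m k;
          ri = sm_tgt m i; rj = sm_tgt m j; rk = sm_tgt m k;
          gi = sm_g m i x; gj = sm_g m j x; gk = sm_g m k x;
          hij = so_g Q (si, sj) x; hjk = so_g Q (sj, sk) x; hik = so_g Q (si, sk) x;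
          gij = so_g P (ri, rj) x; gjk = so_g P (rj, rk) x; gik = so_g P (ri, rk) x;
          clij = sm_cl m (i, j) x; cljk = sm_cl m (j, k) x; clik = sm_cl m (i, k) x;
          crij = sm_cr m (i, j) x; crjk = sm_cr m (j, k) x; crik = sm_cr m (i, k) x;
          cQ = so_c Q (si, sj, sk) x; cP = so_c P (ri, rj, rk) x;
          G = fst gi \<odot> fst hik;
          idx = face S 2 1;
          comp = arr_comp S G (idx clik);
          a1 = arr_prod S (fst gi) (fst hik) clik (face S 3 2 t)
                 (arr_unit S gi) (so_f Q (si, sj, sk) x);
          a2 = comp (idx (face S 3 2 t)) (idx (face S 3 1 t)) a1
                 (assoc_inv S (fst gi) (fst hij) (fst hjk) t);
          a3 = comp (idx (face S 3 1 t)) (idx (face S 3 1 t')) a2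
                 (arr_prod S (fst gi \<odot> fst hij) (fst hjk) (face S 3 1 t) (face S 3 1 t')
                    (sm_f m (i, j) x) (arr_unit S hjk));
          a4 = comp (idx (face S 3 1 t')) (idx (face S 3 2 t')) a3
                 (assoc_arr S (fst gij) (fst gj) (fst hjk) t');
          a5 = comp (idx (face S 3 2 t')) (idx (face S 3 2 t'')) a4
                 (arr_prod S (fst gij) (fst gj \<odot> fst hjk) (face S 3 2 t') (face S 3 2 t'')
                    (arr_unit S gij) (sm_f m (j, k) x));
          a6 = comp (idx (face S 3 2 t'')) (idx (face S 3 1 t'')) a5
                 (assoc_inv S (fst gij) (fst gjk) (fst gk) t'')
      in tup [fst gi, fst hij, fst hjk] \<in> chart S 3 t \<and> face S 3 3 t = clij \<and> face S 3 0 t = cQ \<and>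
         tup [fst gij, fst gj, fst hjk] \<in> chart S 3 t' \<and> face S 3 3 t' = crij \<and> face S 3 0 t' = cljk \<and>
         tup [fst gij, fst gjk, fst gk] \<in> chart S 3 t'' \<and> face S 3 3 t'' = cP \<and> face S 3 0 t'' = crjk
         \<longrightarrow> a6 = comp (idx crik) (idx (face S 3 1 t'')) (sm_f m (i, k) x)
                     (arr_prod S (fst gik) (fst gk) crik (face S 3 1 t'')
                        (so_f P (ri, rj, rk) x) (arr_unit S gk))))"

definition string_mors ::
  "nat \<Rightarrow> 'i presentation \<Rightarrow> rvec set \<Rightarrow> 'i string_obj \<Rightarrow> 'i string_obj \<Rightarrow> 'i string_mor set" where
  "string_mors n S M Q P = {m.
     (let J = sm_idx m; W = sm_cov m; s = sm_src m; r = sm_tgt m; g = sm_g m; A = sm_A m;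
          \<omega>2 = sm_om2 m; f = sm_f m; \<omega>1 = sm_om1 m
      in common_refinement M (so_idx Q) (so_cov Q) (so_idx P) (so_cov P) J W s r \<and>
         g \<in> (\<Pi>\<^sub>E i\<in>J. string_maps n S (W i)) \<and>
         A \<in> (\<Pi>\<^sub>E i\<in>J. form1 (W i) UNIV) \<and>
         \<omega>2 \<in> (\<Pi>\<^sub>E i\<in>J. form2 (W i)) \<and>
         sm_cl m \<in> (\<Pi>\<^sub>E (i, j)\<in>J \<times> J. product_triv S (U2 W i j) (g i) (so_g Q (s i, s j))) \<and>
         sm_cr m \<in> (\<Pi>\<^sub>E (i, j)\<in>J \<times> J. product_triv S (U2 W i j) (so_g P (r i, r j)) (g j)) \<and>
         f \<in> (\<Pi>\<^sub>E (i, j)\<in>J \<times> J. U1fun (U2 W i j)) \<and>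
         \<omega>1 \<in> (\<Pi>\<^sub>E (i, j)\<in>J \<times> J. form1 (U2 W i j) UNIV) \<and>
         (\<forall>i\<in>J. \<forall>x\<in>W i.
            (\<forall>v w. so_B Q (s i) x v w - so_B P (r i) x v w = \<omega>2 i x v w + ext_d1 (W i) (A i) x v w) \<and>
            (\<forall>u v w. ext_d2 (W i) (\<omega>2 i) x u v w
                        = cs3 n (W i) (so_th Q (s i)) x u v w - cs3 n (W i) (so_th P (r i)) x u v w) \<and>
            (\<forall>v. so_th P (r i) x v - Ad (fst (g i x)) (so_th Q (s i) x v)
                        = - mc (W i) (\<lambda>y. fst (g i y)) x v)) \<and>
         (\<forall>i\<in>J. \<forall>j\<in>J. \<forall>x\<in>U2 W i j.
            fst (g i x) \<odot> fst (so_g Q (s i, s j) x) = fst (so_g P (r i, r j) x) \<odot> fst (g j x) \<and>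
            (\<forall>v. so_A P (r i, r j) x v + A j x v - A i x v - so_A Q (s i, s j) x v
                        = \<omega>1 (i, j) x v - dlog (U2 W i j) (f (i, j)) x v) \<and>
            (\<forall>v w. so_om2 P (r i, r j) x v w + \<omega>2 j x v w - so_om2 Q (s i, s j) x v w - \<omega>2 i x v w
                        = - ext_d1 (U2 W i j) (\<omega>1 (i, j)) x v w)) \<and>
         mor_coherence n S Q P m)}"

text \<open>2-morphisms from \<open>m'\<close> (the tilded data) to \<open>m\<close>, both 1-morphisms from \<open>Q\<close> to \<open>P\<close>, live on the
  canonical common refinement \<open>{W' p \<inter> W q}\<close> over \<open>U \<times>\<^sub>M U'\<close>, indexed by the pairs \<open>(p, q)\<close> having the
  same images under the refinement maps. The condition on \<open>\<omega>\<^sup>1\<close> is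
  \<open>\<omega>\<^sup>1\<^sub>i\<^sub>j - \<omega>~\<^sup>1\<^sub>i\<^sub>j = \<omega>\<^sup>1\<^sub>j - \<omega>\<^sup>1\<^sub>i\<close> written with the differences \<open>\<omega>\<^sup>1 - dlog f\<close>, which makes it valid also if
  the trivialisations of \<open>m\<close> and \<open>m'\<close> differ; if they agree, the condition on \<open>f\<close> is
  \<open>f\<^sub>i\<^sub>j / f~\<^sub>i\<^sub>j = f\<^sub>j / f\<^sub>i\<close> and the \<open>dlog\<close> terms cancel.\<close>

definition mor_pairs :: "'i string_mor \<Rightarrow> 'i string_mor \<Rightarrow> (nat \<times> nat) set" where
  "mor_pairs m' m = {(p, q). p \<in> sm_idx m' \<and> q \<in> sm_idx m \<and>
     sm_src m' p = sm_src m q \<and> sm_tgt m' p = sm_tgt m q}"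

type_synonym string_2mor =
  "(nat \<times> nat \<Rightarrow> rvec \<Rightarrow> complex) \<times> (nat \<times> nat \<Rightarrow> rvec \<Rightarrow> rvec \<Rightarrow> real)"

definition string_2mors ::
  "'i presentation \<Rightarrow> 'i string_obj \<Rightarrow> 'i string_obj \<Rightarrow> 'i string_mor \<Rightarrow> 'i string_mor \<Rightarrow>
   string_2mor set" where
  "string_2mors S Q P m' m = {(f, \<omega>).
     (let K = mor_pairs m' m; W = (\<lambda>(p, q). sm_cov m' p \<inter> sm_cov m q)
      in f \<in> (\<Pi>\<^sub>E i\<in>K. U1fun (W i)) \<and>
         \<omega> \<in> (\<Pi>\<^sub>E i\<in>K. form1 (W i) UNIV) \<and>
         (\<forall>(p, q)\<in>K. \<forall>x\<in>W (p, q).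
            fst (sm_g m' p x) = fst (sm_g m q x) \<and>
            (\<forall>v. sm_A m q x v - sm_A m' p x v = - dlog (W (p, q)) (f (p, q)) x v + \<omega> (p, q) x v) \<and>
            (\<forall>v w. sm_om2 m q x v w - sm_om2 m' p x v w = - ext_d1 (W (p, q)) (\<omega> (p, q)) x v w)) \<and>
         (\<forall>(p, q)\<in>K. \<forall>(p', q')\<in>K. \<forall>x\<in>W (p, q) \<inter> W (p', q').
            (let h = so_g Q (sm_src m q, sm_src m q') x; k = so_g P (sm_tgt m q, sm_tgt m q') x;
                 gp = sm_g m' p x; gq = sm_g m q x; gp' = sm_g m' p' x; gq' = sm_g m q' x;
                 clp = sm_cl m' (p, p') x; clq = sm_cl m (q, q') x;
                 crp = sm_cr m' (p, p') x; crq = sm_cr m (q, q') x;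
                 G = fst gp \<odot> fst h
             in arr_comp S G (face S 2 1 clp) (face S 2 1 clq) (face S 2 1 crq)
                  (arr_prod S (fst gp) (fst h) clp clq (f (p, q) x) (arr_unit S h))
                  (sm_f m (q, q') x) =
                arr_comp S G (face S 2 1 clp) (face S 2 1 crp) (face S 2 1 crq)
                  (sm_f m' (p, p') x)
                  (arr_prod S (fst k) (fst gp') crp crq (arr_unit S k) (f (p', q') x))) \<and>
            (let V = W (p, q) \<inter> W (p', q')
             in \<forall>v. (sm_om1 m (q, q') x v - dlog V (sm_f m (q, q')) x v)
                      - (sm_om1 m' (p, p') x v - dlog V (sm_f m' (p, p')) x v)
                    = (\<omega> (p', q') x v - dlog V (f (p', q')) x v)
                      - (\<omega> (p, q) x v - dlog V (f (p, q)) x v))))}"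

section \<open>Transitive Courant data\<close>

text \<open>Fibre elements of \<open>TU \<oplus> \<gg> \<oplus> T\<^sup>*U\<close> are triples; covectors are extended by \<open>0\<close> off the tangent
  space.\<close>

type_synonym ta_elem = "rvec \<times> cl \<times> (rvec \<Rightarrow> real)"

definition ta_fibre :: "nat \<Rightarrow> rvec set \<Rightarrow> rvec \<Rightarrow> ta_elem set" where
  "ta_fibre n U x = {(v, a, l). v \<in> tangent U x \<and> a \<in> so_alg n \<and>
     linear_on_sub (tangent U x) l \<and> (\<forall>w. w \<notin> tangent U x \<longrightarrow> l w = 0)}"

definition ta_sections :: "nat \<Rightarrow> rvec set \<Rightarrow> (rvec \<Rightarrow> ta_elem) set" where
  "ta_sections n U = {s. (\<lambda>x. fst (s x)) \<in> vfields U \<and>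
     smooth_on U (\<lambda>x. fst (snd (s x))) \<and> (\<forall>x\<in>U. fst (snd (s x)) \<in> so_alg n) \<and>
     (\<lambda>x. snd (snd (s x))) \<in> form1 U UNIV}"

definition ta_pairing :: "nat \<Rightarrow> ta_elem \<Rightarrow> ta_elem \<Rightarrow> real" where
  "ta_pairing n = (\<lambda>(v, a, l) (w, b, k). 1 / 2 * (l w + k v) + ip n a b)"

definition ta_bracket ::
  "nat \<Rightarrow> rvec set \<Rightarrow> (rvec \<Rightarrow> ta_elem) \<Rightarrow> (rvec \<Rightarrow> ta_elem) \<Rightarrow> rvec \<Rightarrow> ta_elem" where
  "ta_bracket n U s t x =
     (let X = (\<lambda>y. fst (s y)); a = (\<lambda>y. fst (snd (s y))); \<xi> = (\<lambda>y. snd (snd (s y)));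
          Y = (\<lambda>y. fst (t y)); b = (\<lambda>y. fst (snd (t y))); \<zeta> = (\<lambda>y. snd (snd (t y)))
      in (lie_bracket U X Y x,
          diff U b x (X x) - diff U a x (Y x) + cl_bracket (a x) (b x),
          \<lambda>w. (ext_d1 U \<zeta> x (X x) w + diff U (\<lambda>y. \<zeta> y (X y)) x w)
              - ext_d1 U \<xi> x (Y x) w + 2 * ip n (b x) (diff U a x w)))"

type_synonym ta_map =
  "(rvec \<Rightarrow> rvec \<Rightarrow> cl) \<times> (rvec \<Rightarrow> cl \<Rightarrow> cl) \<times> (rvec \<Rightarrow> rvec \<Rightarrow> rvec \<Rightarrow> real)"

text \<open>The action of the block matrix \<open>(1, 0, 0; \<phi>, \<tau>, 0; \<beta>, -2 \<phi>\<^sup>\<star> \<tau>, 1)\<close> at the point \<open>x\<close>.\<close>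

definition ta_act :: "nat \<Rightarrow> ta_map \<Rightarrow> rvec \<Rightarrow> ta_elem \<Rightarrow> ta_elem" where
  "ta_act n = (\<lambda>(\<phi>, \<tau>, \<beta>) x (v, a, l).
     (v, \<phi> x v + \<tau> x a, \<lambda>w. \<beta> x v w - 2 * ip n (\<tau> x a) (\<phi> x w) + l w))"

definition courant_aut :: "nat \<Rightarrow> rvec set \<Rightarrow> ta_map set" where
  "courant_aut n U = {(\<phi>, \<tau>, \<beta>).
     \<phi> \<in> form1 U (so_alg n) \<and> \<beta> \<in> tensor2 U \<and>
     (\<forall>x a. \<not> (x \<in> U \<and> a \<in> so_alg n) \<longrightarrow> \<tau> x a = 0) \<and>
     (\<forall>x\<in>U. linear_on_sub (so_alg n) (\<tau> x) \<and> bij_betw (\<tau> x) (so_alg n) (so_alg n)) \<and>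
     (\<forall>a\<in>so_alg n. smooth_on U (\<lambda>x. \<tau> x a)) \<and>
     (\<forall>x\<in>U. \<forall>e\<in>ta_fibre n U x. \<forall>e'\<in>ta_fibre n U x.
        ta_pairing n (ta_act n (\<phi>, \<tau>, \<beta>) x e) (ta_act n (\<phi>, \<tau>, \<beta>) x e') = ta_pairing n e e') \<and>
     (\<forall>s\<in>ta_sections n U. \<forall>t\<in>ta_sections n U. \<forall>x\<in>U.
        ta_act n (\<phi>, \<tau>, \<beta>) x (ta_bracket n U s t x) =
        ta_bracket n U (\<lambda>y. ta_act n (\<phi>, \<tau>, \<beta>) y (s y)) (\<lambda>y. ta_act n (\<phi>, \<tau>, \<beta>) y (t y)) x)}"

text \<open>1-morphisms from \<open>(\<theta>', B')\<close> (the tilded data) to \<open>(\<theta>, B)\<close> over \<open>U\<close>.\<close>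

definition courant_1mor ::
  "nat \<Rightarrow> rvec set \<Rightarrow> (rvec \<Rightarrow> rvec \<Rightarrow> cl) \<Rightarrow> (rvec \<Rightarrow> rvec \<Rightarrow> rvec \<Rightarrow> real) \<Rightarrow>
   (rvec \<Rightarrow> rvec \<Rightarrow> cl) \<Rightarrow> (rvec \<Rightarrow> rvec \<Rightarrow> rvec \<Rightarrow> real) \<Rightarrow> ta_map \<Rightarrow> bool" where
  "courant_1mor n U \<theta>' B' \<theta> B = (\<lambda>(\<phi>, \<tau>, \<beta>). (\<phi>, \<tau>, \<beta>) \<in> courant_aut n U \<and>
     (\<forall>x\<in>U.
        (\<forall>v. \<theta> x v = \<tau> x (\<theta>' x v) + \<phi> x v) \<and>
        (\<forall>v w. B' x v w - B x v w = \<beta> x v w + ip n (\<theta> x w) (\<theta> x v) - ip n (\<theta>' x w) (\<theta>' x v)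
                  - 2 * ip n (\<tau> x (\<theta>' x v)) (\<phi> x w)) \<and>
        (\<forall>u v w. cs3 n U \<theta>' x u v w - cs3 n U \<theta> x u v w
                  = ext_d2 U (\<lambda>y v w. B' y v w - B y v w) x u v w)))"

record courant_obj =
  co_idx :: "nat set"
  co_cov :: "nat \<Rightarrow> rvec set"
  co_th :: "nat \<Rightarrow> rvec \<Rightarrow> rvec \<Rightarrow> cl"
  co_B :: "nat \<Rightarrow> rvec \<Rightarrow> rvec \<Rightarrow> rvec \<Rightarrow> real"
  co_map :: "nat \<times> nat \<Rightarrow> ta_map"

definition courant_objs :: "nat \<Rightarrow> rvec set \<Rightarrow> courant_obj set" where
  "courant_objs n M = {P.
     (let I = co_idx P; U = co_cov P; \<theta> = co_th P; B = co_B P; L = co_map P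
      in open_cover M I U \<and>
         \<theta> \<in> (\<Pi>\<^sub>E i\<in>I. form1 (U i) (so_alg n)) \<and>
         B \<in> (\<Pi>\<^sub>E i\<in>I. form2 (U i)) \<and>
         L \<in> extensional (I \<times> I) \<and>
         (\<forall>i\<in>I. \<forall>j\<in>I. courant_1mor n (U2 U i j) (\<theta> j) (B j) (\<theta> i) (B i) (L (i, j))) \<and>
         (\<forall>i\<in>I. \<forall>j\<in>I. \<forall>k\<in>I. \<forall>x\<in>U3 U i j k. \<forall>e\<in>ta_fibre n M x.
            ta_act n (L (i, j)) x (ta_act n (L (j, k)) x e) = ta_act n (L (i, k)) x e))}"

record courant_mor =
  cm_idx :: "nat set"
  cm_cov :: "nat \<Rightarrow> rvec set"
  cm_src :: "nat \<Rightarrow> nat"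
  cm_tgt :: "nat \<Rightarrow> nat"
  cm_map :: "nat \<Rightarrow> ta_map"

definition courant_mors ::
  "nat \<Rightarrow> rvec set \<Rightarrow> courant_obj \<Rightarrow> courant_obj \<Rightarrow> courant_mor set" where
  "courant_mors n M Q P = {m.
     (let J = cm_idx m; W = cm_cov m; s = cm_src m; r = cm_tgt m; L = cm_map m
      in common_refinement M (co_idx Q) (co_cov Q) (co_idx P) (co_cov P) J W s r \<and>
         L \<in> extensional J \<and>
         (\<forall>i\<in>J. courant_1mor n (W i) (co_th Q (s i)) (co_B Q (s i)) (co_th P (r i)) (co_B P (r i)) (L i)) \<and>
         (\<forall>i\<in>J. \<forall>j\<in>J. \<forall>x\<in>U2 W i j. \<forall>e\<in>ta_fibre n M x.
            ta_act n (co_map P (r i, r j)) x (ta_act n (L j) x e) =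
            ta_act n (L i) x (ta_act n (co_map Q (s i, s j)) x e)))}"

text \<open>The only 2-morphisms are identities: 1-morphisms over different refinements are identified if
  they agree over the common refinement.\<close>

definition courant_2mors :: "nat \<Rightarrow> rvec set \<Rightarrow> courant_mor \<Rightarrow> courant_mor \<Rightarrow> unit set" where
  "courant_2mors n M m' m = {_.
     \<forall>p\<in>cm_idx m'. \<forall>q\<in>cm_idx m. cm_src m' p = cm_src m q \<and> cm_tgt m' p = cm_tgt m q \<longrightarrow>
       (\<forall>x\<in>cm_cov m' p \<inter> cm_cov m q. \<forall>e\<in>ta_fibre n M x.
          ta_act n (cm_map m' p) x e = ta_act n (cm_map m q) x e)}"

section \<open>The map \<open>\<Phi>\<close>\<close>

definition Phi_map ::
  "nat \<Rightarrow> rvec set \<Rightarrow> (rvec \<Rightarrow> rvec \<Rightarrow> cl) \<Rightarrow> (rvec \<Rightarrow> cl) \<Rightarrow>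
   (rvec \<Rightarrow> rvec \<Rightarrow> real) \<Rightarrow> (rvec \<Rightarrow> rvec \<Rightarrow> rvec \<Rightarrow> real) \<Rightarrow> ta_map" where
  "Phi_map n U \<theta> g A \<omega>2 =
     (let \<mu> = mc U g
      in (\<lambda>x v. if x \<in> U then - \<mu> x v else 0,
          \<lambda>x a. if x \<in> U \<and> a \<in> so_alg n then Ad (g x) a else 0,
          \<lambda>x v w. if x \<in> U then ext_d1 U A x v w + \<omega>2 x v w
             + ip n (\<mu> x v) (\<theta> x w) - ip n (\<mu> x w) (\<theta> x v) - ip n (\<mu> x v) (\<mu> x w) else 0))"

definition Phi_obj :: "nat \<Rightarrow> 'i string_obj \<Rightarrow> courant_obj" where
  "Phi_obj n P = \<lparr>co_idx = so_idx P, co_cov = so_cov P, co_th = so_th P, co_B = so_B P,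
     co_map = restrict (\<lambda>(i, j). Phi_map n (U2 (so_cov P) i j) (so_th P i)
        (\<lambda>x. fst (so_g P (i, j) x)) (so_A P (i, j)) (so_om2 P (i, j))) (so_idx P \<times> so_idx P)\<rparr>"

text \<open>For a 1-morphism to the string data \<open>P\<close>; the form \<open>\<theta>\<^sub>i\<close> in the formula is that of \<open>P\<close>.\<close>

definition Phi_mor :: "nat \<Rightarrow> 'i string_obj \<Rightarrow> 'i string_mor \<Rightarrow> courant_mor" where
  "Phi_mor n P m = \<lparr>cm_idx = sm_idx m, cm_cov = sm_cov m, cm_src = sm_src m, cm_tgt = sm_tgt m,
     cm_map = restrict (\<lambda>i. Phi_map n (sm_cov m i) (so_th P (sm_tgt m i))
        (\<lambda>x. fst (sm_g m i x)) (sm_A m i) (sm_om2 m i)) (sm_idx m)\<rparr>"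

definition Phi_2mor :: "string_2mor \<Rightarrow> unit" where
  "Phi_2mor _ = ()"

text \<open>Equivalences between groupoids, given by objects and hom-sets: full, faithful and essentially
  surjective. As all arrows are invertible, two objects are isomorphic iff there is an arrow between
  them. (All 2-morphisms of string and of Courant data are invertible.)\<close>

definition groupoid_equivalence ::
  "'o set \<Rightarrow> ('o \<Rightarrow> 'o \<Rightarrow> 'h set) \<Rightarrow> 'p set \<Rightarrow> ('p \<Rightarrow> 'p \<Rightarrow> 'k set) \<Rightarrow>
   ('o \<Rightarrow> 'p) \<Rightarrow> ('o \<Rightarrow> 'o \<Rightarrow> 'h \<Rightarrow> 'k) \<Rightarrow> bool" where
  "groupoid_equivalence Ob Hom Ob' Hom' F0 F1 \<longleftrightarrow>
     (\<forall>x\<in>Ob. \<forall>y\<in>Ob. bij_betw (F1 x y) (Hom x y) (Hom' (F0 x) (F0 y))) \<and>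
     (\<forall>z\<in>Ob'. \<exists>x\<in>Ob. Hom' (F0 x) z \<noteq> {})"

definition Phi_hom_equivalence ::
  "nat \<Rightarrow> 'i presentation \<Rightarrow> rvec set \<Rightarrow> 'i string_obj \<Rightarrow> 'i string_obj \<Rightarrow> bool" where
  "Phi_hom_equivalence n S M P P' \<longleftrightarrow>
     groupoid_equivalence
       (string_mors n S M P P') (string_2mors S P P')
       (courant_mors n M (Phi_obj n P) (Phi_obj n P')) (courant_2mors n M)
       (Phi_mor n P') (\<lambda>_ _. Phi_2mor)"

end

theory Submission
  imports Defs
begin

text \<open>Over a point all forms vanish, and both failures come from the constants in \<open>U(1)\<close>: \<open>\<Phi>\<close> forgets
  the isomorphisms \<open>f\<^sub>i\<^sub>j\<^sub>k\<close>, and it forgets the 2-morphisms. It remains to see that string data over a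
  point exist for every presentation. The hypercover condition yields indices \<open>a\<^sub>k\<close> over \<open>(1, \<dots>, 1)\<close> all
  of whose faces are \<open>a\<^sub>k\<^sub>-\<^sub>1\<close>. The cocycle condition at \<open>a\<^sub>4\<close> reads \<open>\<Theta>(a\<^sub>3) = 1\<close>, as five alternating
  factors leave one; hence the constant data at \<open>a\<^sub>1\<close>, \<open>a\<^sub>2\<close> satisfy the pentagon for every constant
  \<open>f \<in> U(1)\<close>.\<close>

section \<open>Calculus on a point\<close>

lemma Ck_on_const: "Ck_on k U (\<lambda>_. c)"
  by (induction k arbitrary: c) auto

lemma smooth_on_const: "smooth_on S (\<lambda>_. c)"
  unfolding smooth_on_def
  by (auto intro!: exI[of _ UNIV] exI[of _ "\<lambda>_. c"] simp: Ck_on_const)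

text \<open>On a single point every map agrees with a constant, which is smooth on the ambient
  space.\<close>

lemma smooth_on_singleton [simp]: "smooth_on {x} f"
  unfolding smooth_on_def
  by (auto intro!: exI[of _ UNIV] exI[of _ "\<lambda>_. f x"] simp: Ck_on_const)

lemma open_in_singleton [simp]: "open_in {x} {x}"
  by (simp add: open_in_def)

lemma loc_const_singleton [simp]: "loc_const {x} c"
  by (auto simp: loc_const_def intro!: exI[of _ "{x}"])

lemma curve_in_singletonD:
  assumes "curve_in {x} \<gamma> y v"
  shows "y = x" "\<forall>\<^sub>F t in nhds 0. \<gamma> t = x"
proof -
  obtain e where e: "e > 0" "\<gamma> ` {-e<..<e} \<subseteq> {x}"
    using assms by (auto simp: curve_in_def)
  have "\<forall>\<^sub>F t in nhds 0. t \<in> {-e<..<e}"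
    using e(1) by (intro eventually_nhds_in_open) auto
  then show "\<forall>\<^sub>F t in nhds 0. \<gamma> t = x"
    by eventually_elim (use e(2) in blast)
  have "\<gamma> 0 = y" using assms by (simp add: curve_in_def)
  then show "y = x"
    using e by force
qed

lemma curve_in_singleton_const: "curve_in {x} (\<lambda>_. x) x 0"
  by (auto simp: curve_in_def smooth_on_const intro: exI[of _ 1])

text \<open>A curve in a point is constant near 0, so \<open>f\<close> along it is constant there,
  whatever \<open>f\<close> is. With \<open>f\<close> the identity this determines the tangent
  space.\<close>

lemma has_vector_derivative_along_singleton:
  assumes "curve_in {x} \<gamma> y v" "((\<lambda>t. f (\<gamma> t)) has_vector_derivative r) (at 0)"
  shows "r = 0"
proof -
  have "\<forall>\<^sub>F t in nhds 0. f (\<gamma> t) = f x"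
    using curve_in_singletonD(2)[OF assms(1)] by eventually_elim simp
  then have "((\<lambda>t. f x) has_vector_derivative r) (at 0)"
    using assms(2) has_vector_derivative_cong_ev[where S = UNIV and x = 0 and f = "\<lambda>t. f (\<gamma> t)" and g = "\<lambda>_. f x"]
    using eventually_nhds_x_imp_x by auto
  then show ?thesis
    using vector_derivative_unique_at has_vector_derivative_const by blast
qed

lemma tangent_singleton: "tangent {x} y = (if y = x then {0} else {})"
proof -
  have "v = 0 \<and> y = x" if "curve_in {x} \<gamma> y v" for \<gamma> v
    using has_vector_derivative_along_singleton[OF that, of "\<lambda>z. z"] that
      curve_in_singletonD(1)[OF that]
    by (simp add: curve_in_def)
  then show ?thesis
    using curve_in_singleton_const[of x] by (auto simp: tangent_def)
qed

text \<open>The definite description in \<open>diff\<close> has a witness, the constant curve, and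
  every derivative along a curve in the point is 0.\<close>

lemma diff_singleton [simp]: "diff {x} f y v = 0"
proof -
  have "(THE r. \<exists>\<gamma>. curve_in {x} \<gamma> x 0 \<and> ((\<lambda>t. f (\<gamma> t)) has_vector_derivative r) (at 0)) = 0"
  proof (rule the_equality)
    show "\<exists>\<gamma>. curve_in {x} \<gamma> x 0 \<and> ((\<lambda>t. f (\<gamma> t)) has_vector_derivative 0) (at 0)"
      using curve_in_singleton_const by force
  qed (blast dest: has_vector_derivative_along_singleton)
  then show ?thesis
    by (simp add: diff_def tangent_singleton)
qed

lemma dlog_singleton [simp]: "dlog {x} f y v = 0"
  by (simp add: dlog_def)

lemma zero_vfield_singleton: "(\<lambda>_. 0) \<in> vfields {x}"
  by (simp add: vfields_def tangent_singleton)

text \<open>Stated for arbitrary \<open>S\<close>, because the Koszul formulas differentiate over an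
  open subset \<open>W\<close> that stays a bound variable when they are unfolded.\<close>

lemma diff_const [simp]: "diff S (\<lambda>_. c) x v = 0"
proof (cases "x \<in> S \<and> v \<in> tangent S x")
  case True
  have "(THE r. \<exists>\<gamma>. curve_in S \<gamma> x v \<and> ((\<lambda>t. c) has_vector_derivative r) (at 0)) = 0"
    using True vector_derivative_unique_at[of "\<lambda>_. c" _ 0 0]
    by (intro the_equality) (auto simp: tangent_def)
  then show ?thesis
    by (simp add: diff_def)
qed (auto simp: diff_def)

lemma ext_d1_zero_singleton [simp]:
  fixes x :: "'a::real_normed_vector"
  shows "ext_d1 {x} (\<lambda>_ _. 0 :: 'b::real_normed_vector) y v w = 0"
proof -
  \<comment> \<open>The zero vector fields show that the description in the Koszul formula is
    satisfiable; its value is then 0 because every term vanishes.\<close>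
  have "\<exists>W X Y. open_in {x} W \<and> x \<in> W \<and> X \<in> vfields W \<and> Y \<in> vfields W \<and> X x = 0 \<and> Y x = 0"
    using zero_vfield_singleton[of x] open_in_singleton[of x] by blast
  then show ?thesis
    by (auto simp: ext_d1_def tangent_singleton intro!: the_equality)
qed

lemma ext_d2_zero_singleton [simp]: "ext_d2 {x} (\<lambda>_ _ _. 0) y u v w = 0"
proof -
  have "\<exists>W X Y Z. open_in {x} W \<and> x \<in> W \<and> X \<in> vfields W \<and> Y \<in> vfields W \<and> Z \<in> vfields W \<and>
      X x = 0 \<and> Y x = 0 \<and> Z x = 0"
    using zero_vfield_singleton[of x] open_in_singleton[of x] by blast
  then show ?thesis
    by (auto simp: ext_d2_def tangent_singleton intro!: the_equality)
qed

lemma zero_form1_singleton [simp]: "0 \<in> V \<Longrightarrow> (\<lambda>_ _. 0) \<in> form1 {x} V"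
  by (auto simp: form1_def linear_on_sub_def smooth_on_const)

lemma zero_form2_singleton [simp]: "(\<lambda>_ _ _. 0) \<in> form2 {x}"
  by (auto simp: form2_def tensor2_def linear_on_sub_def smooth_on_const)

lemma submanifold_origin: "submanifold 0 {0}"
proof -
  have "coords 0 = {0}"
    by (auto simp: coords_def)
  then show ?thesis
    by (force simp: submanifold_def homeomorphism_def
      intro!: exI[of _ "{0}"] exI[of _ "\<lambda>x. x"])
qed

lemma const_U1fun_singleton [simp]:
  "restrict (\<lambda>_. a) {x} \<in> U1fun {x} \<longleftrightarrow> cmod a = 1"
  by (simp add: U1fun_def)

section \<open>The unit of the Spin group\<close>

lemma cl_mult_zero [simp]: "x \<odot> 0 = 0" "0 \<odot> x = 0"
  by (simp_all add: cl_mult_def)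

lemma cl_one_mult_one [simp]: "cl_one \<odot> cl_one = cl_one"
  by (simp add: cl_mult_def cl_one_def cl_sign_def)

lemma cl_one_Spin [simp]: "cl_one \<in> Spin n"
  unfolding Spin_def by (auto intro!: exI[of _ "[]"])

lemma zero_so_alg [simp]: "0 \<in> so_alg n"
  by (simp add: so_alg_def)

lemma Ad_zero [simp]: "Ad g 0 = 0"
  by (simp add: Ad_def)

lemma mc_singleton [simp]: "mc {x} h y v = 0"
  by (simp add: mc_def)

lemma cs3_zero_singleton [simp]: "cs3 n {x} (\<lambda>_ _. 0) y u v w = 0"
  by (simp add: cs3_def wedge12_def ip_def cl_bracket_def)

lemma lookup_tup: "Poly_Mapping.lookup (tup gs) i = (if i < length gs then gs ! i else 0)"
  by (simp add: tup_def lookup_sum lookup_single when_def)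

definition unit_tup :: "nat \<Rightarrow> bg" where
  "unit_tup k = tup (replicate k cl_one)"

lemma tup_units:
  "tup [cl_one] = unit_tup 1" "tup [cl_one, cl_one] = unit_tup 2"
  "tup [cl_one, cl_one, cl_one] = unit_tup 3"
  by (simp_all add: unit_tup_def eval_nat_numeral)

lemma unit_tup_BG: "unit_tup k \<in> BG n k"
  by (auto simp: BG_def unit_tup_def intro!: exI[of _ "replicate k cl_one"])

text \<open>A face map drops an outer entry or multiplies two neighbours, and 1 times 1 is
  1.\<close>

lemma bg_face_unit_tup:
  assumes "k \<ge> 1"
  shows "bg_face k j (unit_tup k) = unit_tup (k - 1)"
  unfolding bg_face_def unit_tup_def using assms
  by (intro arg_cong[where f = tup] nth_equalityI) (auto simp: lookup_tup)

section \<open>The presentation at the unit\<close>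

lemma alternating_prod:
  fixes g :: "nat \<Rightarrow> complex"
  shows "(\<Prod>j\<le>2. g j powi ((-1) ^ j)) = g 0 / g 1 * g 2"
    "(\<Prod>j\<le>3. g j powi ((-1) ^ j)) = g 0 / g 1 * g 2 / g 3"
    "(\<Prod>j\<le>4. g j powi ((-1) ^ j)) = g 0 / g 1 * g 2 / g 3 * g 4"
  by (simp_all add: eval_nat_numeral atMost_Suc power_int_minus divide_inverse mult_ac)

text \<open>The family constantly \<open>a\<close> lies in the matching object: both sides of each
  simplicial identity are the common face \<open>a'\<close>. The hypercover condition then lifts it
  to level \<open>k\<close>.\<close>

lemma hypercover_constant_index:
  assumes hc: "good_hypercover n S" and k: "k \<ge> 1"
    and a: "a \<in> Idx S (k - 1)" "unit_tup (k - 1) \<in> chart S (k - 1) a"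
    and faces: "\<And>i. k \<ge> 2 \<Longrightarrow> i \<le> k - 1 \<Longrightarrow> face S (k - 1) i a = a'"
  obtains b where "b \<in> Idx S k" "unit_tup k \<in> chart S k b" "\<And>j. j \<le> k \<Longrightarrow> face S k j b = a"
proof -
  have step: "\<forall>k\<ge>1. \<forall>b x. (\<forall>j\<le>k. b j \<in> Idx S (k - 1)) \<and>
        (k \<ge> 2 \<longrightarrow> (\<forall>j\<le>k. \<forall>i<j. face S (k - 1) i (b j) = face S (k - 1) (j - 1) (b i))) \<and>
        x \<in> BG n k \<and> (\<forall>j\<le>k. bg_face k j x \<in> chart S (k - 1) (b j)) \<longrightarrow>
        (\<exists>a\<in>Idx S k. x \<in> chart S k a \<and> (\<forall>j\<le>k. face S k j a = b j))"
    using hc unfolding good_hypercover_def by (elim conjE)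
  have "\<exists>b\<in>Idx S k. unit_tup k \<in> chart S k b \<and> (\<forall>j\<le>k. face S k j b = a)"
  proof (rule step[rule_format, OF k, of "\<lambda>_. a" "unit_tup k"], intro conjI allI impI)
    fix i j assume "k \<ge> 2" "j \<le> k" "i < j"
    then have "i \<le> k - 1" "j - 1 \<le> k - 1" by linarith+
    with \<open>k \<ge> 2\<close> show "face S (k - 1) i a = face S (k - 1) (j - 1) a"
      by (simp only: faces)
  qed (use a k in \<open>simp_all only: unit_tup_BG bg_face_unit_tup\<close>)
  then show ?thesis
    using that by blast
qed

lemma hypercover_face:
  assumes "good_hypercover n S" "k \<ge> 1" "j \<le> k" "a \<in> Idx S k" "unit_tup k \<in> chart S k a"
  shows "face S k j a \<in> Idx S (k - 1)" "unit_tup (k - 1) \<in> chart S (k - 1) (face S k j a)"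
proof -
  have "\<forall>k\<ge>1. \<forall>j\<le>k. \<forall>a\<in>Idx S k. face S k j a \<in> Idx S (k - 1) \<and>
        bg_face k j ` chart S k a \<subseteq> chart S (k - 1) (face S k j a)"
    using assms(1) unfolding good_hypercover_def by (elim conjE)
  then have "face S k j a \<in> Idx S (k - 1) \<and> bg_face k j ` chart S k a \<subseteq> chart S (k - 1) (face S k j a)"
    using assms(2-4) by blast
  then show "face S k j a \<in> Idx S (k - 1)" "unit_tup (k - 1) \<in> chart S (k - 1) (face S k j a)"
    using imageI[OF assms(5), of "bg_face k j"] by (auto simp only: bg_face_unit_tup[OF assms(2)])
qed

lemma face_face:
  assumes "good_hypercover n S" "a \<in> Idx S (Suc k)" "k \<ge> 1" "i < j" "j \<le> Suc k"
  shows "face S k i (face S (Suc k) j a) = face S k (j - 1) (face S (Suc k) i a)"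
proof -
  have "\<forall>k\<ge>2. \<forall>a\<in>Idx S k. \<forall>j\<le>k. \<forall>i<j.
        face S (k - 1) i (face S k j a) = face S (k - 1) (j - 1) (face S k i a)"
    using assms(1) unfolding good_hypercover_def by (elim conjE)
  from this[rule_format, of "Suc k" a j i] assms show ?thesis
    by simp
qed

text \<open>The tower stands in for the iterated degeneracies of an index over the point, since a
  presentation carries face maps only. Level 4 serves to evaluate \<Theta> at
  \<open>a3\<close>.\<close>

locale constant_index =
  fixes n :: nat and S :: "'i presentation" and a1 a2 a3 a4 :: 'i
  assumes hypercover: "good_hypercover n S" and cocycle: "string_cocycle n S"
    and a1: "a1 \<in> Idx S 1" "unit_tup 1 \<in> chart S 1 a1"
    and a2: "a2 \<in> Idx S 2" "unit_tup 2 \<in> chart S 2 a2" "\<And>j. j \<le> 2 \<Longrightarrow> face S 2 j a2 = a1"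
    and a3: "a3 \<in> Idx S 3" "unit_tup 3 \<in> chart S 3 a3" "\<And>j. j \<le> 3 \<Longrightarrow> face S 3 j a3 = a2"
    and a4: "a4 \<in> Idx S 4" "unit_tup 4 \<in> chart S 4 a4" "\<And>j. j \<le> 4 \<Longrightarrow> face S 4 j a4 = a3"

lemma constant_index_exists:
  assumes "string_presentation n S"
  obtains a1 a2 a3 a4 where "constant_index n S a1 a2 a3 a4"
proof -
  have hc: "good_hypercover n S" and co: "string_cocycle n S"
    using assms by (auto simp: string_presentation_def)
  have "BG n 0 \<subseteq> (\<Union>a\<in>Idx S 0. chart S 0 a)"
    using hc unfolding good_hypercover_def by (elim conjE)
  then obtain a0 where a0: "a0 \<in> Idx S 0" "unit_tup 0 \<in> chart S 0 a0"
    using unit_tup_BG[of 0 n] by blast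
  obtain a1 where a1: "a1 \<in> Idx S 1" "unit_tup 1 \<in> chart S 1 a1"
      "\<And>j. j \<le> 1 \<Longrightarrow> face S 1 j a1 = a0"
    \<comment> \<open>At level 1 no compatibility of faces is asked for, so any value may stand for
      the common face.\<close>
    using hypercover_constant_index[OF hc, of 1 a0 undefined] a0 by auto
  obtain a2 where a2: "a2 \<in> Idx S 2" "unit_tup 2 \<in> chart S 2 a2"
      "\<And>j. j \<le> 2 \<Longrightarrow> face S 2 j a2 = a1"
    using hypercover_constant_index[OF hc, of 2 a1 a0] a1 by auto
  obtain a3 where a3: "a3 \<in> Idx S 3" "unit_tup 3 \<in> chart S 3 a3"
      "\<And>j. j \<le> 3 \<Longrightarrow> face S 3 j a3 = a2"
    using hypercover_constant_index[OF hc, of 3 a2 a1] a2 by auto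
  obtain a4 where a4: "a4 \<in> Idx S 4" "unit_tup 4 \<in> chart S 4 a4"
      "\<And>j. j \<le> 4 \<Longrightarrow> face S 4 j a4 = a3"
    using hypercover_constant_index[OF hc, of 4 a3 a2] a3 by auto
  have "constant_index n S a1 a2 a3 a4"
    by unfold_locales (use hc co a1 a2 a3 a4 in auto)
  then show ?thesis
    by (rule that)
qed

section \<open>Cocycle identities at the unit tuple\<close>

context constant_index
begin

abbreviation E where "E p q r \<equiv> eta S p q r (unit_tup 1)"
abbreviation Ps where "Ps p q \<equiv> Psi S p q (unit_tup 2)"
abbreviation Th where "Th t \<equiv> Theta S t (unit_tup 3)"

definition unit_idx :: "nat \<Rightarrow> 'i set" where
  "unit_idx k = {a \<in> Idx S k. unit_tup k \<in> chart S k a}"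

lemma a_idx: "a1 \<in> unit_idx 1" "a2 \<in> unit_idx 2" "a3 \<in> unit_idx 3" "a4 \<in> unit_idx 4"
  using a1 a2 a3 a4 by (simp_all add: unit_idx_def)

lemma face_idx: "a \<in> unit_idx k \<Longrightarrow> k \<ge> 1 \<Longrightarrow> j \<le> k \<Longrightarrow> face S k j a \<in> unit_idx (k - 1)"
  using hypercover_face[OF hypercover] by (simp add: unit_idx_def)

lemma eta_norm: "p \<in> unit_idx 1 \<Longrightarrow> q \<in> unit_idx 1 \<Longrightarrow> r \<in> unit_idx 1 \<Longrightarrow> cmod (E p q r) = 1"
  using cocycle by (auto simp: string_cocycle_def U1_on_def unit_idx_def)

lemma Psi_norm: "p \<in> unit_idx 2 \<Longrightarrow> q \<in> unit_idx 2 \<Longrightarrow> cmod (Ps p q) = 1"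
  using cocycle by (auto simp: string_cocycle_def U1_on_def unit_idx_def)

lemma Theta_norm: "t \<in> unit_idx 3 \<Longrightarrow> cmod (Th t) = 1"
  using cocycle by (auto simp: string_cocycle_def U1_on_def unit_idx_def)

lemma eta_nonzero: "p \<in> unit_idx 1 \<Longrightarrow> q \<in> unit_idx 1 \<Longrightarrow> r \<in> unit_idx 1 \<Longrightarrow> E p q r \<noteq> 0"
  and Psi_nonzero: "p' \<in> unit_idx 2 \<Longrightarrow> q' \<in> unit_idx 2 \<Longrightarrow> Ps p' q' \<noteq> 0"
  and Theta_nonzero: "t \<in> unit_idx 3 \<Longrightarrow> Th t \<noteq> 0"
  using eta_norm Psi_norm Theta_norm by fastforce+

lemma eta_cocycle:
  "p \<in> unit_idx 1 \<Longrightarrow> q \<in> unit_idx 1 \<Longrightarrow> r \<in> unit_idx 1 \<Longrightarrow> s \<in> unit_idx 1 \<Longrightarrow> E q r s * E p q s = E p r s * E p q r"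
  using cocycle by (auto simp: string_cocycle_def unit_idx_def)

text \<open>Cancel \<open>E p p q\<close> in the cocycle identity for \<open>p, p, p, q\<close>.
  This and the next lemma say that \<open>arr_unit\<close> is a two-sided identity for
  \<open>arr_comp\<close>.\<close>

lemma eta_left_unit: "q \<in> unit_idx 1 \<Longrightarrow> p \<in> unit_idx 1 \<Longrightarrow> E p p q = E p p p"
  using eta_cocycle[of p p p q] eta_nonzero[of p p q] by auto

lemma eta_right_unit: "p \<in> unit_idx 1 \<Longrightarrow> q \<in> unit_idx 1 \<Longrightarrow> E p q q = E q q q"
  using eta_cocycle[of p q q q] eta_nonzero[of p q q] by auto

text \<open>This is the compatibility of the product of arrows with their composition, read off at
  the unit.\<close>

lemma Psi_cocycle:
  assumes "p \<in> unit_idx 2" "q \<in> unit_idx 2" "r \<in> unit_idx 2"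
  shows "E (face S 2 0 p) (face S 2 0 q) (face S 2 0 r) * E (face S 2 2 p) (face S 2 2 q) (face S 2 2 r)
      / E (face S 2 1 p) (face S 2 1 q) (face S 2 1 r) * (Ps q r / Ps p r * Ps p q) = 1"
proof -
  have "\<forall>a\<in>Idx S 2. \<forall>b\<in>Idx S 2. \<forall>c\<in>Idx S 2. \<forall>x\<in>chart S 2 a \<inter> chart S 2 b \<inter> chart S 2 c.
        (\<Prod>j\<le>2. eta S (face S 2 j a) (face S 2 j b) (face S 2 j c) (bg_face 2 j x) powi ((-1) ^ j))
          * (Psi S b c x / Psi S a c x * Psi S a b x) = 1"
    using cocycle unfolding string_cocycle_def by (elim conjE)
  from this[rule_format, of p q r "unit_tup 2"] assms show ?thesis
    by (simp add: unit_idx_def bg_face_unit_tup alternating_prod)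
qed

lemma Theta_cocycle:
  assumes "s \<in> unit_idx 3" "t \<in> unit_idx 3"
  shows "Ps (face S 3 0 s) (face S 3 0 t) / Ps (face S 3 1 s) (face S 3 1 t)
      * Ps (face S 3 2 s) (face S 3 2 t) / Ps (face S 3 3 s) (face S 3 3 t) = Th t / Th s"
proof -
  have "\<forall>a\<in>Idx S 3. \<forall>b\<in>Idx S 3. \<forall>x\<in>chart S 3 a \<inter> chart S 3 b.
        (\<Prod>j\<le>3. Psi S (face S 3 j a) (face S 3 j b) (bg_face 3 j x) powi ((-1) ^ j))
          = Theta S b x / Theta S a x"
    using cocycle unfolding string_cocycle_def by (elim conjE)
  from this[rule_format, of s t "unit_tup 3"] assms show ?thesis
    by (simp add: unit_idx_def bg_face_unit_tup alternating_prod)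
qed

lemma Theta_a3: "Th a3 = 1"
proof -
  have "\<forall>a\<in>Idx S 4. \<forall>x\<in>chart S 4 a.
        (\<Prod>j\<le>4. Theta S (face S 4 j a) (bg_face 4 j x) powi ((-1) ^ j)) = 1"
    using cocycle unfolding string_cocycle_def by (elim conjE)
  from this[rule_format, of a4 "unit_tup 4"] a4 Theta_nonzero[OF a_idx(3)] show ?thesis
    by (simp add: bg_face_unit_tup alternating_prod)
qed

text \<open>The indices \<open>t\<close> over which the pentagon and the coherence condition are tested.\<close>

definition test_idx :: "'i set" where
  "test_idx = {t \<in> unit_idx 3. face S 3 3 t = a2 \<and> face S 3 0 t = a2}"

lemma test_idx_faces:
  assumes "t \<in> test_idx"
  shows "face S 2 0 (face S 3 1 t) = a1" "face S 2 2 (face S 3 1 t) = a1"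
    "face S 2 0 (face S 3 2 t) = a1" "face S 2 2 (face S 3 2 t) = a1"
    "face S 2 1 (face S 3 2 t) = face S 2 1 (face S 3 1 t)"
    "face S 3 1 t \<in> unit_idx 2" "face S 3 2 t \<in> unit_idx 2" "face S 2 1 (face S 3 1 t) \<in> unit_idx 1"
    "t \<in> unit_idx 3" "face S 3 0 t = a2" "face S 3 3 t = a2"
proof -
  have t: "t \<in> Idx S (Suc 2)" "t \<in> unit_idx 3" "face S 3 0 t = a2" "face S 3 3 t = a2"
    using assms by (auto simp: test_idx_def unit_idx_def)
  note ff = face_face[OF hypercover t(1)]
  \<comment> \<open>Writing \<open>d\<close> for faces, the identities used are
    \<open>d0 d1 = d0 d0\<close>, \<open>d1 d3 = d2 d1\<close>, \<open>d0 d2 = d1 d0\<close>,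
    \<open>d2 d3 = d2 d2\<close> and \<open>d1 d2 = d1 d1\<close>; the two outer faces of
    \<open>t\<close> are \<open>a2\<close>, all of whose faces are \<open>a1\<close>.\<close>
  show "face S 2 0 (face S 3 1 t) = a1" "face S 2 2 (face S 3 1 t) = a1"
    "face S 2 0 (face S 3 2 t) = a1" "face S 2 2 (face S 3 2 t) = a1"
    "face S 2 1 (face S 3 2 t) = face S 2 1 (face S 3 1 t)"
    using ff[of 0 1] ff[of 1 3] ff[of 0 2] ff[of 2 3] ff[of 1 2] t a2(3) by simp_all
  show "face S 3 1 t \<in> unit_idx 2" "face S 3 2 t \<in> unit_idx 2"
    using face_idx[OF t(2), of 1] face_idx[OF t(2), of 2] by simp_all
  then show "face S 2 1 (face S 3 1 t) \<in> unit_idx 1"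
    using face_idx[of "face S 3 1 t" 2 1] by simp
qed (use assms in \<open>auto simp: test_idx_def\<close>)

text \<open>Compare \<open>t\<close> with \<open>a3\<close>, where \<Theta> is 1: the outer faces
  contribute \<open>Ps a2 a2\<close> to numerator and denominator and cancel. Thus \<Theta> at
  \<open>t\<close> is a ratio of transition functions from \<open>a2\<close>.\<close>

lemma Theta_test:
  assumes "t \<in> test_idx"
  shows "Ps a2 (face S 3 1 t) * Th t = Ps a2 (face S 3 2 t)"
  using Theta_cocycle[OF a_idx(3), of t] test_idx_faces[OF assms] a3(3) Theta_a3
    Psi_nonzero[OF a_idx(2) a_idx(2)] Psi_nonzero[OF a_idx(2), of "face S 3 1 t"]
  by (simp add: field_simps)

text \<open>The cocycle identity for \<open>a2, p, q\<close>: each outer face contributes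
  \<open>E a1 a1 a1\<close>, and only the middle face sees the indices of the products.\<close>

lemma Psi_comp:
  assumes "p \<in> unit_idx 2" "q \<in> unit_idx 2" "face S 2 0 p = a1" "face S 2 2 p = a1" "face S 2 0 q = a1" "face S 2 2 q = a1"
  shows "Ps a2 p * Ps p q * (E a1 a1 a1)\<^sup>2 = Ps a2 q * E a1 (face S 2 1 p) (face S 2 1 q)"
  using Psi_cocycle[OF a_idx(2) assms(1,2)] assms a2(3) a_idx(1)
    eta_nonzero[OF a_idx(1), of "face S 2 1 p" "face S 2 1 q"] face_idx[of p 2 1] face_idx[of q 2 1]
    Psi_nonzero[OF a_idx(2) assms(2)]
  by (simp add: field_simps power2_eq_square)

end

section \<open>String data over a point\<close>

context constant_index
begin

text \<open>The trivial bundle on the one-set cover, with the constant \<phi> as its only freedom.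
  Each \<open>restrict\<close> is there because string data are required to be extensional, in the
  cover indices and, for maps, in the points.\<close>

definition pt_obj :: "complex \<Rightarrow> 'i string_obj" where
  "pt_obj \<phi> = \<lparr>so_idx = {0}, so_cov = restrict (\<lambda>_. {0}) {0},
     so_th = restrict (\<lambda>_ _ _. 0) {0}, so_B = restrict (\<lambda>_ _ _ _. 0) {0},
     so_g = restrict (\<lambda>_. restrict (\<lambda>_. (cl_one, a1)) {0}) ({0} \<times> {0}),
     so_A = restrict (\<lambda>_ _ _. 0) ({0} \<times> {0}), so_om2 = restrict (\<lambda>_ _ _ _. 0) ({0} \<times> {0}),
     so_c = restrict (\<lambda>_. restrict (\<lambda>_. a2) {0}) ({0} \<times> {0} \<times> {0}),
     so_f = restrict (\<lambda>_. restrict (\<lambda>_. \<phi>) {0}) ({0} \<times> {0} \<times> {0}),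
     so_om1 = restrict (\<lambda>_ _ _. 0) ({0} \<times> {0} \<times> {0})\<rparr>"

text \<open>An endomorphism of \<open>pt_obj \<phi>\<close> for every \<phi>. Its component
  \<open>sm_f\<close> is the identity arrow at \<open>a1\<close>, which in the groupoid of \<eta> is
  \<open>E a1 a1 a1\<close> and not 1.\<close>

definition pt_mor :: "'i string_mor" where
  "pt_mor = \<lparr>sm_idx = {0}, sm_cov = restrict (\<lambda>_. {0}) {0},
     sm_src = restrict (\<lambda>_. 0) {0}, sm_tgt = restrict (\<lambda>_. 0) {0},
     sm_g = restrict (\<lambda>_. restrict (\<lambda>_. (cl_one, a1)) {0}) {0},
     sm_A = restrict (\<lambda>_ _ _. 0) {0}, sm_om2 = restrict (\<lambda>_ _ _ _. 0) {0},
     sm_cl = restrict (\<lambda>_. restrict (\<lambda>_. a2) {0}) ({0} \<times> {0}),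
     sm_cr = restrict (\<lambda>_. restrict (\<lambda>_. a2) {0}) ({0} \<times> {0}),
     sm_f = restrict (\<lambda>_. restrict (\<lambda>_. E a1 a1 a1) {0}) ({0} \<times> {0}),
     sm_om1 = restrict (\<lambda>_ _ _. 0) ({0} \<times> {0})\<rparr>"

definition pt_2mor :: "complex \<Rightarrow> string_2mor" where
  "pt_2mor z = (restrict (\<lambda>_. restrict (\<lambda>_. z) {0}) {(0, 0)}, restrict (\<lambda>_ _ _. 0) {(0, 0)})"

lemma pt_obj_sel:
  "so_idx (pt_obj \<phi>) = {0}" "so_cov (pt_obj \<phi>) = restrict (\<lambda>_. {0}) {0}"
  "so_th (pt_obj \<phi>) = restrict (\<lambda>_ _ _. 0) {0}" "so_B (pt_obj \<phi>) = restrict (\<lambda>_ _ _ _. 0) {0}"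
  "so_g (pt_obj \<phi>) = restrict (\<lambda>_. restrict (\<lambda>_. (cl_one, a1)) {0}) ({0} \<times> {0})"
  "so_A (pt_obj \<phi>) = restrict (\<lambda>_ _ _. 0) ({0} \<times> {0})"
  "so_om2 (pt_obj \<phi>) = restrict (\<lambda>_ _ _ _. 0) ({0} \<times> {0})"
  "so_c (pt_obj \<phi>) = restrict (\<lambda>_. restrict (\<lambda>_. a2) {0}) ({0} \<times> {0} \<times> {0})"
  "so_f (pt_obj \<phi>) = restrict (\<lambda>_. restrict (\<lambda>_. \<phi>) {0}) ({0} \<times> {0} \<times> {0})"
  "so_om1 (pt_obj \<phi>) = restrict (\<lambda>_ _ _. 0) ({0} \<times> {0} \<times> {0})"
  by (simp_all add: pt_obj_def)

lemma pt_mor_sel: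
  "sm_idx pt_mor = {0}" "sm_cov pt_mor = restrict (\<lambda>_. {0}) {0}"
  "sm_src pt_mor = restrict (\<lambda>_. 0) {0}" "sm_tgt pt_mor = restrict (\<lambda>_. 0) {0}"
  "sm_g pt_mor = restrict (\<lambda>_. restrict (\<lambda>_. (cl_one, a1)) {0}) {0}"
  "sm_A pt_mor = restrict (\<lambda>_ _ _. 0) {0}" "sm_om2 pt_mor = restrict (\<lambda>_ _ _ _. 0) {0}"
  "sm_cl pt_mor = restrict (\<lambda>_. restrict (\<lambda>_. a2) {0}) ({0} \<times> {0})"
  "sm_cr pt_mor = restrict (\<lambda>_. restrict (\<lambda>_. a2) {0}) ({0} \<times> {0})"
  "sm_f pt_mor = restrict (\<lambda>_. restrict (\<lambda>_. E a1 a1 a1) {0}) ({0} \<times> {0})"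
  "sm_om1 pt_mor = restrict (\<lambda>_ _ _. 0) ({0} \<times> {0})"
  by (simp_all add: pt_mor_def)

lemma test_idx_iff:
  "t \<in> test_idx \<longleftrightarrow> t \<in> Idx S 3 \<and> unit_tup 3 \<in> chart S 3 t \<and> face S 3 3 t = a2 \<and> face S 3 0 t = a2"
  by (auto simp: test_idx_def unit_idx_def)

text \<open>Both composites contain \<phi> twice, so its value does not matter;
  \<open>Theta_test\<close> absorbs the associator and \<open>eta_right_unit\<close> the unit arrow
  in it.\<close>

lemma pentagon_pt_obj: "pentagon n S (pt_obj \<phi>)"
proof -
  \<comment> \<open>The pentagon after unfolding, with \<open>q\<close> the index of the triple
    product.\<close>
  have "\<phi> * (E a1 a1 a1 * \<phi> * Ps a2 e) / E a1 a1 (face S 2 1 e) =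
      \<phi> * (\<phi> * E a1 a1 a1 * Ps a2 d) * (Th t * E q q q) / (E a1 a1 q * E a1 q (face S 2 1 e))"
    if "t \<in> test_idx" "d = face S 3 1 t" "e = face S 3 2 t" "q = face S 2 1 d" for t d e q
    using Theta_test[OF that(1)] test_idx_faces(5,8)[OF that(1)] that(2-) eta_nonzero[of q q q]
      eta_right_unit[OF a_idx(1), of q]
    by (simp del: One_nat_def)
  then show ?thesis
    unfolding pentagon_def pt_obj_sel Let_def
    by (simp add: arr_comp_def arr_prod_def arr_unit_def assoc_arr_def assoc_idx_def tup_units
        a2(3) test_idx_iff del: One_nat_def)
qed

lemma pt_obj_in_string_objs:
  assumes "cmod \<phi> = 1"
  shows "pt_obj \<phi> \<in> string_objs n S {0}"
  unfolding string_objs_def Let_def pt_obj_sel mem_Collect_eq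
  by (intro conjI pentagon_pt_obj)
    (use assms a1 a2 in \<open>simp_all add: open_cover_def string_maps_def product_triv_def tup_units\<close>)

text \<open>The factor \<open>Ps a2 _\<close> is carried along the chain \<open>e\<close>,
  \<open>d\<close>, \<open>d'\<close>, \<open>e'\<close>, \<open>e''\<close>, \<open>d''\<close>, by
  \<open>Theta_test\<close> within one test index and by \<open>Psi_comp\<close> from one to the
  next. The factors picked up on the way are cancelled by the denominator, and \<phi> occurs once on
  each side.\<close>

lemma mor_coherence_pt_mor: "mor_coherence n S (pt_obj \<phi>) (pt_obj \<phi>) pt_mor"
proof -
  \<comment> \<open>The unfolded coherence condition. The faces are variables with defining
    equations as premises, so that the rule matches the expanded goal while the computation stays
    readable.\<close>
  have eq: "u * \<phi> * Ps a2 e * E q q q * (u * u * Ps d d') * (Th t' * E q' q' q')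
      * (u * u * Ps e' e'') * E q'' q'' q''
      / (Th t * E a1 (face S 2 1 e) q * E a1 q q' * E a1 q' (face S 2 1 e')
        * E a1 (face S 2 1 e') (face S 2 1 e'') * Th t'' * E a1 (face S 2 1 e'') q'')
      = u * (\<phi> * u * Ps a2 d'') / E a1 a1 q''"
    if t: "t \<in> test_idx" "d = face S 3 1 t" "e = face S 3 2 t" "q = face S 2 1 d"
      and t': "t' \<in> test_idx" "d' = face S 3 1 t'" "e' = face S 3 2 t'" "q' = face S 2 1 d'"
      and t'': "t'' \<in> test_idx" "d'' = face S 3 1 t''" "e'' = face S 3 2 t''" "q'' = face S 2 1 d''"
      and u: "u = E a1 a1 a1"
    for t d e q t' d' e' q' t'' d'' e'' q'' u
  proof -
    note faces = test_idx_faces[OF t(1)] test_idx_faces[OF t'(1)] test_idx_faces[OF t''(1)]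
    have q: "q \<in> unit_idx 1" "q' \<in> unit_idx 1" "q'' \<in> unit_idx 1"
      and e: "face S 2 1 e = q" "face S 2 1 e' = q'" "face S 2 1 e'' = q''"
      using faces t t' t'' by (simp_all del: One_nat_def)
    have Th: "Ps a2 d * Th t = Ps a2 e" "Ps a2 d' * Th t' = Ps a2 e'" "Ps a2 d'' * Th t'' = Ps a2 e''"
      using Theta_test[OF t(1)] Theta_test[OF t'(1)] Theta_test[OF t''(1)] t t' t'' by simp_all
    have comp: "Ps a2 d * Ps d d' * u\<^sup>2 = Ps a2 d' * E a1 q q'"
      "Ps a2 e' * Ps e' e'' * u\<^sup>2 = Ps a2 e'' * E a1 q' q''"
      using Psi_comp[of d d'] Psi_comp[of e' e''] faces t t' t'' e u by (simp_all del: One_nat_def)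
    have "u * \<phi> * Ps a2 e * (u * u * Ps d d') * Th t' * (u * u * Ps e' e'')
        = u * \<phi> * Th t * (Ps a2 d * Ps d d' * u\<^sup>2) * Th t' * u\<^sup>2 * Ps e' e''"
      by (simp add: power2_eq_square flip: Th)
    also have "\<dots> = u * \<phi> * Th t * E a1 q q' * (Ps a2 e' * Ps e' e'' * u\<^sup>2)"
      by (simp add: comp(1) flip: Th)
    also have "\<dots> = u * \<phi> * Th t * E a1 q q' * (Ps a2 d'' * Th t'' * E a1 q' q'')"
      by (simp only: comp(2) Th)
    finally have main: "u * \<phi> * Ps a2 e * (u * u * Ps d d') * Th t' * (u * u * Ps e' e'')
        = u * \<phi> * Ps a2 d'' * (Th t * E a1 q q' * E a1 q' q'' * Th t'')"
      by (simp only: mult_ac)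
    have nz: "Th t * E a1 q q' * E a1 q' q'' * Th t'' \<noteq> 0" "u \<noteq> 0" "E q q q * E q' q' q' * E q'' q'' q'' \<noteq> 0"
      using Theta_nonzero faces eta_nonzero q a_idx(1) u by auto
    have units: "E a1 q q = E q q q" "E a1 q' q' = E q' q' q'" "E a1 q'' q'' = E q'' q'' q''" "E a1 a1 q'' = u"
      using eta_right_unit[OF a_idx(1)] eta_left_unit q a_idx(1) u by blast+
    \<comment> \<open>The unit arrows of the three associators are split off as a common factor;
      what remains is \<open>main\<close>.\<close>
    have "u * \<phi> * Ps a2 e * E q q q * (u * u * Ps d d') * (Th t' * E q' q' q')
        * (u * u * Ps e' e'') * E q'' q'' q''
        / (Th t * E a1 q q * E a1 q q' * E a1 q' q' * E a1 q' q'' * Th t'' * E a1 q'' q'')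
        = (u * \<phi> * Ps a2 e * (u * u * Ps d d') * Th t' * (u * u * Ps e' e''))
          * (E q q q * E q' q' q' * E q'' q'' q'')
          / ((Th t * E a1 q q' * E a1 q' q'' * Th t'') * (E q q q * E q' q' q' * E q'' q'' q''))"
      by (simp only: units mult_ac)
    also have "\<dots> = u * \<phi> * Ps a2 d''"
      unfolding main mult_divide_mult_cancel_right[OF nz(3)] by (rule nonzero_mult_div_cancel_right[OF nz(1)])
    finally show ?thesis
      unfolding e units using nz(2) by simp
  qed
  show ?thesis
    unfolding mor_coherence_def pt_mor_sel pt_obj_sel Let_def
    by (simp add: arr_comp_def arr_prod_def arr_unit_def assoc_arr_def assoc_inv_def assoc_idx_def
        tup_units a2(3) del: One_nat_def) (intro ballI impI, rule eq; simp add: test_idx_iff)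
qed

lemma pt_mor_in_string_mors: "pt_mor \<in> string_mors n S {0} (pt_obj \<phi>) (pt_obj \<phi>)"
  unfolding string_mors_def Let_def pt_mor_sel pt_obj_sel mem_Collect_eq
  by (intro conjI mor_coherence_pt_mor)
    (use a1 a2 eta_norm[of a1 a1 a1] a_idx(1) in
      \<open>simp_all add: common_refinement_def string_maps_def product_triv_def tup_units\<close>)

text \<open>In the condition on \<open>f\<close> the constant \<open>z\<close> enters each composite
  once, and U(1) is abelian; the form conditions are trivial over a point.\<close>

lemma pt_2mor_in_string_2mors:
  assumes "cmod z = 1"
  shows "pt_2mor z \<in> string_2mors S (pt_obj \<phi>) (pt_obj \<phi>) pt_mor pt_mor"
proof -
  have "mor_pairs pt_mor pt_mor = {(0, 0)}"
    by (auto simp: mor_pairs_def pt_mor_sel)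
  then show ?thesis
    using assms
    by (simp add: string_2mors_def pt_2mor_def pt_obj_sel pt_mor_sel Let_def
        arr_comp_def arr_prod_def arr_unit_def tup_units)
qed

section \<open>Failure of injectivity on objects and of faithfulness on 2-morphisms\<close>

lemma Phi_obj_not_inj: "\<not> inj_on (Phi_obj n) (string_objs n S {0})"
proof
  assume inj: "inj_on (Phi_obj n) (string_objs n S {0})"
  \<comment> \<open>Two distinct elements of U(1) suffice, since \<open>Phi_obj\<close> does not
    read \<open>so_f\<close>.\<close>
  have "Phi_obj n (pt_obj 1) = Phi_obj n (pt_obj (-1))"
    by (simp add: Phi_obj_def pt_obj_sel)
  then have "pt_obj 1 = pt_obj (-1)"
    using inj pt_obj_in_string_objs[of 1] pt_obj_in_string_objs[of "-1"] by (simp add: inj_on_eq_iff)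
  then have "so_f (pt_obj 1) (0, 0, 0) 0 = so_f (pt_obj (-1)) (0, 0, 0) 0"
    by simp
  then show False
    by (simp add: pt_obj_sel)
qed

text \<open>An equivalence would make \<open>Phi_2mor\<close>, which has only one value, injective
  on the 2-endomorphisms of \<open>pt_mor\<close>; the constants 1 and -1 give two of them.\<close>

lemma not_Phi_hom_equivalence: "\<not> Phi_hom_equivalence n S {0} (pt_obj \<phi>) (pt_obj \<phi>)"
proof
  assume "Phi_hom_equivalence n S {0} (pt_obj \<phi>) (pt_obj \<phi>)"
  then have "inj_on Phi_2mor (string_2mors S (pt_obj \<phi>) (pt_obj \<phi>) pt_mor pt_mor)"
    using pt_mor_in_string_mors[of \<phi>]
    by (auto simp: Phi_hom_equivalence_def groupoid_equivalence_def bij_betw_def)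
  then have "pt_2mor 1 = pt_2mor (-1)"
    using pt_2mor_in_string_2mors[of 1 \<phi>] pt_2mor_in_string_2mors[of "-1" \<phi>]
    by (auto simp: inj_on_def Phi_2mor_def)
  then have "fst (pt_2mor 1) (0, 0) 0 = fst (pt_2mor (-1)) (0, 0) 0"
    by simp
  then show False
    by (simp add: pt_2mor_def)
qed

end

theorem lemma5p8:
  shows "\<exists>n\<ge>3. \<exists>m M. submanifold m M \<and> M \<noteq> {} \<and>
    (\<forall>S :: 'i presentation. string_presentation n S \<longrightarrow>
       \<not> inj_on (Phi_obj n) (string_objs n S M) \<and>
       (\<exists>P\<in>string_objs n S M. \<exists>P'\<in>string_objs n S M. \<not> Phi_hom_equivalence n S M P P'))"
proof -
  have "\<not> inj_on (Phi_obj 3) (string_objs 3 S {0}) \<and>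
      (\<exists>P\<in>string_objs 3 S {0}. \<exists>P'\<in>string_objs 3 S {0}. \<not> Phi_hom_equivalence 3 S {0} P P')"
    if S: "string_presentation 3 S" for S :: "'i presentation"
  proof -
    obtain a1 a2 a3 a4 where "constant_index 3 S a1 a2 a3 a4"
      using constant_index_exists[OF S] by blast
    then interpret constant_index 3 S a1 a2 a3 a4 .
    show ?thesis
      using Phi_obj_not_inj pt_obj_in_string_objs[of 1] not_Phi_hom_equivalence by auto
  qed
  then show ?thesis
    \<comment> \<open>The witnesses are the least admissible \<open>n\<close> and the origin as a
      0-dimensional manifold; the locale itself treats every \<open>n\<close>.\<close>
    using submanifold_origin by (intro exI[of _ 3]) (auto intro!: exI[of _ 0] exI[of _ "{0}"])
qed

end
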